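(* Fix a positive integer $\alpha$. For every positive integer $k$ and all $\epsilon>0$, $\delta>0$ there exists $N_0\ge k$ such that for every $N\ge N_0$ and all $g,h\in \mathrm{U}(\alpha+2k)$ the $\tau_{g,h}$-measure of the $\epsilon$-neighborhood (in $G_N=\mathrm{U}(\alpha+2(k+N))$, with respect to the operator-norm metric) of the double coset $g\circ_N h\subset G_N$ is $\ge 1-\delta$.
   Context: $\mathrm{U}(n)$ is the group of unitary $n\times n$ matrices and $\mathrm{O}(n)$ the group of real orthogonal $n\times n$ matrices; $1_n$ is the identity matrix of size $n$. Put $G_N:=\mathrm{U}(\alpha+2(k+N))$, with the metric $d(g,h)=\|g-h\|$, where $\|\cdot\|$ is the norm of an operator in a Euclidean space. For a subset $A\subset G_N$, its $\epsilon$-neighborhood is the set of $x\in G_N$ at distance $<\epsilon$ from $A$. Matrices in $G_N$ are written in blocks of sizes $\alpha+k+N+k+N$. The group $\mathrm{U}(\alpha+2k)$ is regarded as the subgroup of $G_N$ consisting of the matrices $$\begin{pmatrix} a&b_1&0&b_2&0\\ c_1&d_{11}&0&d_{12}&0\\ 0&0&1_N&0&0\\ c_2&d_{21}&0&d_{22}&0\\ 0&0&0&0&1_N\end{pmatrix},\qquad \begin{pmatrix} a&b_1&b_2\\ c_1&d_{11}&d_{12}\\ c_2&d_{21}&d_{22}\end{pmatrix}\in \mathrm{U}(\alpha+2k)$$ (the latter in blocks of sizes $\alpha+k+k$). The subgroup $K_N\simeq \mathrm{O}(k+N)$ of $G_N$ consists of the matrices $$\begin{pmatrix}1_\alpha&0&0\\0&x&0\\0&0&x\end{pmatrix},\qquad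 x\in \mathrm{O}(k+N)$$ (blocks of sizes $\alpha+(k+N)+(k+N)$, with the same $x$ in both places). Let $\kappa_N$ be the Haar probability measure of $K_N$, regarded as a measure on $G_N$, and let $\delta_g$ be the unit point mass at $g$. For $g,h\in \mathrm{U}(\alpha+2k)$ define the probability measure on $G_N$ $$\tau_{g,h}:=\kappa_N*\delta_g*\kappa_N*\delta_h*\kappa_N,$$ where $*$ is convolution of measures on $G_N$, i.e. $\int \phi\, d(\mu*\nu)=\iint \phi(g_1g_2)\,d\mu(g_1)\,d\nu(g_2)$ for continuous $\phi$. For $N\ge k$ let (blocks of sizes $\alpha+k+k+(N-k)+k+k+(N-k)$) $$J_N:=\begin{pmatrix} 1_\alpha&0&0&0&0&0&0\\ 0&0&1_k&0&0&0&0\\ 0&1_k&0&0&0&0&0\\ 0&0&0&1_{N-k}&0&0&0\\ 0&0&0&0&0&1_k&0\\ 0&0&0&0&1_k&0&0\\ 0&0&0&0&0&0&1_{N-k} \end{pmatrix}\in G_N.$$ For $g,h\in \mathrm{U}(\alpha+2k)\subset G_N$ the element $g\circ_N h\in K_N\setminus G_N/K_N$ is the double coset $$g\circ_N h:=K_N\, gJ_Nh\, K_N .$$ *)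

theory Defs
  imports "HOL-Probability.Probability" "Jordan_Normal_Form.Schur_Decomposition"
begin

definition unitary_group :: "nat \<Rightarrow> complex mat set" where
  "unitary_group n = {A \<in> carrier_mat n n. A * mat_adjoint A = 1\<^sub>m n}"

definition orthogonal_group :: "nat \<Rightarrow> real mat set" where
  "orthogonal_group n = {A \<in> carrier_mat n n. A * transpose_mat A = 1\<^sub>m n}"

definition G_grp :: "nat \<Rightarrow> nat \<Rightarrow> nat \<Rightarrow> complex mat set" where
  "G_grp \<alpha> k N = unitary_group (\<alpha> + 2 * (k + N))"

definition K_grp :: "nat \<Rightarrow> nat \<Rightarrow> nat \<Rightarrow> complex mat set" where
  "K_grp \<alpha> k N =
     (\<lambda>x. diag_block_mat [1\<^sub>m \<alpha>, map_mat complex_of_real x, map_mat complex_of_real x])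
       ` orthogonal_group (k + N)"

text \<open>
  The embedding of \<open>U(\<alpha> + 2k)\<close> into \<open>U(\<alpha> + 2(k + N))\<close>. The matrix is cut into four blocks
  with respect to \<open>(\<alpha> + k) + k\<close>, so that the blocks \<open>A, B, C, D\<close> below are
  \<open>(a, b\<^sub>1; c\<^sub>1, d\<^sub>1\<^sub>1)\<close>, \<open>(b\<^sub>2; d\<^sub>1\<^sub>2)\<close>, \<open>(c\<^sub>2, d\<^sub>2\<^sub>1)\<close> and \<open>d\<^sub>2\<^sub>2\<close>.
\<close>

definition embed_G :: "nat \<Rightarrow> nat \<Rightarrow> nat \<Rightarrow> complex mat \<Rightarrow> complex mat" where
  "embed_G \<alpha> k N g = (case split_block g (\<alpha> + k) (\<alpha> + k) of (A, B, C, D) \<Rightarrow>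
     four_block_mat
       (four_block_mat A (0\<^sub>m (\<alpha> + k) N) (0\<^sub>m N (\<alpha> + k)) (1\<^sub>m N))
       (four_block_mat B (0\<^sub>m (\<alpha> + k) N) (0\<^sub>m N k) (0\<^sub>m N N))
       (four_block_mat C (0\<^sub>m k N) (0\<^sub>m N (\<alpha> + k)) (0\<^sub>m N N))
       (four_block_mat D (0\<^sub>m k N) (0\<^sub>m N k) (1\<^sub>m N)))"

definition swap_mat :: "nat \<Rightarrow> complex mat" where
  "swap_mat k = four_block_mat (0\<^sub>m k k) (1\<^sub>m k) (1\<^sub>m k) (0\<^sub>m k k)"

text \<open>Meaningful only for \<open>k \<le> N\<close>, as \<open>N - k\<close> is truncated subtraction.\<close>

definition J_mat :: "nat \<Rightarrow> nat \<Rightarrow> nat \<Rightarrow> complex mat" where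
  "J_mat \<alpha> k N =
     diag_block_mat [1\<^sub>m \<alpha>, swap_mat k, 1\<^sub>m (N - k), swap_mat k, 1\<^sub>m (N - k)]"

text \<open>For \<open>g, h \<in> U(\<alpha> + 2k)\<close>, the double coset \<open>K g J h K\<close>, as a subset of \<open>G\<close>.\<close>

definition circ_coset ::
    "nat \<Rightarrow> nat \<Rightarrow> nat \<Rightarrow> complex mat \<Rightarrow> complex mat \<Rightarrow> complex mat set" where
  "circ_coset \<alpha> k N g h =
     {u * (embed_G \<alpha> k N g * J_mat \<alpha> k N * embed_G \<alpha> k N h) * v | u v.
        u \<in> K_grp \<alpha> k N \<and> v \<in> K_grp \<alpha> k N}"

text \<open>
  The operator norm with respect to the Euclidean norms, and its metric. On matrices of different
  sizes the difference is unspecified, and \<open>Metric_space\<close> requires a distance to be symmetric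
  everywhere; hence the value \<open>0\<close> there.
\<close>

definition vec_l2_norm :: "complex vec \<Rightarrow> real" where
  "vec_l2_norm v = L2_set (\<lambda>i. cmod (vec_index v i)) {..<dim_vec v}"

definition op_norm :: "complex mat \<Rightarrow> real" where
  "op_norm A =
     (SUP v \<in> {v \<in> carrier_vec (dim_col A). vec_l2_norm v \<le> 1}. vec_l2_norm (A *\<^sub>v v))"

definition op_dist :: "complex mat \<Rightarrow> complex mat \<Rightarrow> real" where
  "op_dist A B =
     (if dim_row A = dim_row B \<and> dim_col A = dim_col B then op_norm (A - B) else 0)"

lemma bdd_above_op_norm:
  "bdd_above ((\<lambda>v. vec_l2_norm (A *\<^sub>v v)) ` {v \<in> carrier_vec (dim_col A). vec_l2_norm v \<le> 1})"
proof (rule bdd_aboveI2)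
  fix v assume v: "v \<in> {v \<in> carrier_vec (dim_col A). vec_l2_norm v \<le> 1}"
  then have d: "dim_vec v = dim_col A" and n: "vec_l2_norm v \<le> 1" by auto
  have e: "cmod (vec_index v j) \<le> 1" if "j < dim_col A" for j
    using member_le_L2_set[of "{..<dim_vec v}" j "\<lambda>i. cmod (vec_index v i)"] that d n
    unfolding vec_l2_norm_def by auto
  have "vec_l2_norm (A *\<^sub>v v) \<le> (\<Sum>i<dim_row A. cmod (vec_index (A *\<^sub>v v) i))"
    unfolding vec_l2_norm_def dim_mult_mat_vec by (rule L2_set_le_sum) simp
  also have "\<dots> \<le> (\<Sum>i<dim_row A. \<Sum>j<dim_col A. cmod (A $$ (i, j)))"
  proof (rule sum_mono)
    fix i assume i: "i \<in> {..<dim_row A}"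
    have "cmod (vec_index (A *\<^sub>v v) i) = cmod (\<Sum>j<dim_col A. A $$ (i, j) * vec_index v j)"
      using i d by (simp add: scalar_prod_def lessThan_atLeast0)
    also have "\<dots> \<le> (\<Sum>j<dim_col A. cmod (A $$ (i, j) * vec_index v j))"
      by (rule norm_sum)
    also have "\<dots> \<le> (\<Sum>j<dim_col A. cmod (A $$ (i, j)))"
      by (rule sum_mono) (use e in \<open>auto simp: norm_mult mult_left_le\<close>)
    finally show "cmod (vec_index (A *\<^sub>v v) i) \<le> (\<Sum>j<dim_col A. cmod (A $$ (i, j)))" .
  qed
  finally show "vec_l2_norm (A *\<^sub>v v) \<le> (\<Sum>i<dim_row A. \<Sum>j<dim_col A. cmod (A $$ (i, j)))" .
qed

lemma vec_l2_norm_le_op_norm: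
  "v \<in> carrier_vec (dim_col A) \<Longrightarrow> vec_l2_norm v \<le> 1 \<Longrightarrow> vec_l2_norm (A *\<^sub>v v) \<le> op_norm A"
  unfolding op_norm_def by (rule cSUP_upper[OF _ bdd_above_op_norm]) auto

lemma vec_l2_norm_nonneg: "0 \<le> vec_l2_norm v"
  unfolding vec_l2_norm_def by (rule L2_set_nonneg)

lemma vec_l2_norm_zero: "vec_l2_norm (0\<^sub>v n) = 0"
  unfolding vec_l2_norm_def by (simp add: L2_set_def)

lemma op_norm_nonneg: "0 \<le> op_norm A"
  using vec_l2_norm_le_op_norm[of "0\<^sub>v (dim_col A)" A]
    vec_l2_norm_nonneg[of "A *\<^sub>v 0\<^sub>v (dim_col A)"] vec_l2_norm_zero[of "dim_col A"] by simp

lemma op_norm_leI: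
  assumes "\<And>v. v \<in> carrier_vec (dim_col A) \<Longrightarrow> vec_l2_norm v \<le> 1 \<Longrightarrow> vec_l2_norm (A *\<^sub>v v) \<le> c"
  shows "op_norm A \<le> c"
  unfolding op_norm_def
proof (rule cSUP_least)
  have "0\<^sub>v (dim_col A) \<in> {v \<in> carrier_vec (dim_col A). vec_l2_norm v \<le> 1}"
    by (simp add: vec_l2_norm_zero)
  then show "{v \<in> carrier_vec (dim_col A). vec_l2_norm v \<le> 1} \<noteq> {}" by blast
qed (use assms in auto)

lemma op_norm_entry:
  assumes "i < dim_row A" "j < dim_col A"
  shows "cmod (A $$ (i, j)) \<le> op_norm A"
proof -
  have "(\<Sum>l<dim_col A. (cmod (vec_index (unit_vec (dim_col A) j) l))\<^sup>2)
      = (\<Sum>l<dim_col A. if l = j then 1 else 0)"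
    using assms by (intro sum.cong) auto
  then have u: "vec_l2_norm (unit_vec (dim_col A) j) \<le> 1"
    using assms by (simp add: vec_l2_norm_def L2_set_def)
  have "cmod (A $$ (i, j)) = cmod (vec_index (A *\<^sub>v unit_vec (dim_col A) j) i)"
    using assms by simp
  also have "\<dots> \<le> vec_l2_norm (A *\<^sub>v unit_vec (dim_col A) j)"
    unfolding vec_l2_norm_def
    by (rule member_le_L2_set[where f = "\<lambda>i. cmod (vec_index (A *\<^sub>v unit_vec (dim_col A) j) i)"])
      (use assms in auto)
  also have "\<dots> \<le> op_norm A"
    by (rule vec_l2_norm_le_op_norm) (use u in auto)
  finally show ?thesis .
qed

lemma op_norm_minus_commute:
  assumes "A \<in> carrier_mat m n" "B \<in> carrier_mat m n"
  shows "op_norm (A - B) = op_norm (B - A)"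
proof -
  have "vec_l2_norm ((A - B) *\<^sub>v v) = vec_l2_norm ((B - A) *\<^sub>v v)" if "v \<in> carrier_vec n" for v
    using assms that
    by (auto simp: vec_l2_norm_def minus_mult_distrib_mat_vec norm_minus_commute
        intro!: L2_set_cong)
  then show ?thesis
    using assms unfolding op_norm_def by (auto intro!: SUP_cong)
qed

lemma op_norm_triangle:
  assumes "A \<in> carrier_mat m n" "B \<in> carrier_mat m n" "C \<in> carrier_mat m n"
  shows "op_norm (A - C) \<le> op_norm (A - B) + op_norm (B - C)"
proof (rule op_norm_leI)
  fix v assume v: "v \<in> carrier_vec (dim_col (A - C))" "vec_l2_norm v \<le> 1"
  then have vn: "v \<in> carrier_vec n" using assms by simp
  have "vec_l2_norm ((A - C) *\<^sub>v v)
      \<le> L2_set (\<lambda>i. cmod (vec_index ((A - B) *\<^sub>v v) i) + cmod (vec_index ((B - C) *\<^sub>v v) i)) {..<m}"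
    using assms vn
    unfolding vec_l2_norm_def
    by (auto simp: minus_mult_distrib_mat_vec
        intro!: L2_set_mono norm_diff_triangle_le[OF order_refl order_refl])
  also have "\<dots> \<le> vec_l2_norm ((A - B) *\<^sub>v v) + vec_l2_norm ((B - C) *\<^sub>v v)"
    using assms L2_set_triangle_ineq[of "\<lambda>i. cmod (vec_index ((A - B) *\<^sub>v v) i)"
        "\<lambda>i. cmod (vec_index ((B - C) *\<^sub>v v) i)" "{..<m}"]
    by (simp add: vec_l2_norm_def)
  also have "\<dots> \<le> op_norm (A - B) + op_norm (B - C)"
    using assms vn v(2) by (intro add_mono vec_l2_norm_le_op_norm) auto
  finally show "vec_l2_norm ((A - C) *\<^sub>v v) \<le> op_norm (A - B) + op_norm (B - C)" .
qed

lemma Metric_space_op_dist: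
  assumes "S \<subseteq> carrier_mat m n"
  shows "Metric_space S op_dist"
proof
  fix x y :: "complex mat"
  show "0 \<le> op_dist x y"
    by (simp add: op_dist_def op_norm_nonneg)
  show "op_dist x y = op_dist y x"
    using op_norm_minus_commute[of x "dim_row y" "dim_col y" y]
    unfolding op_dist_def carrier_mat_def by auto
next
  fix x y assume "x \<in> S" "y \<in> S"
  then have xy: "x \<in> carrier_mat m n" "y \<in> carrier_mat m n" using assms by auto
  show "op_dist x y = 0 \<longleftrightarrow> x = y"
  proof
    assume z: "op_dist x y = 0"
    show "x = y"
    proof (rule eq_matI)
      fix i j assume "i < dim_row y" "j < dim_col y"
      then show "x $$ (i, j) = y $$ (i, j)"
        using op_norm_entry[of i "x - y" j] z xy by (simp add: op_dist_def)
    qed (use xy in auto)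
  next
    assume "x = y"
    then have "op_norm (x - y) \<le> 0"
      using xy
      by (intro op_norm_leI) (auto simp: vec_l2_norm_def L2_set_def minus_mult_distrib_mat_vec)
    with op_norm_nonneg[of "x - y"] \<open>x = y\<close> show "op_dist x y = 0"
      by (simp add: op_dist_def)
  qed
next
  fix x y z assume "x \<in> S" "y \<in> S" "z \<in> S"
  then have "x \<in> carrier_mat m n" "y \<in> carrier_mat m n" "z \<in> carrier_mat m n"
    using assms by auto
  then show "op_dist x z \<le> op_dist x y + op_dist y z"
    using op_norm_triangle[of x m n y z] by (auto simp: op_dist_def)
qed

definition nbhd :: "complex mat set \<Rightarrow> real \<Rightarrow> complex mat set \<Rightarrow> complex mat set" where
  "nbhd G \<epsilon> A = {x \<in> G. \<exists>a\<in>A. op_dist x a < \<epsilon>}"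

text \<open>
  The Borel \<open>\<sigma>\<close>-algebra of a set \<open>S\<close> of matrices of one size, metrized by the operator norm.
  The type of matrices carries no topology, so the type class \<open>borel\<close> is not available.
\<close>

definition mat_borel :: "complex mat set \<Rightarrow> complex mat measure" where
  "mat_borel S = sigma S {U. openin (Metric_space.mtopology S op_dist) U}"

text \<open>
  A Haar probability measure of a compact matrix group \<open>K\<close>: a left-invariant Borel probability
  measure. Regularity is automatic, since \<open>K\<close> is a compact metric space.
\<close>

definition haar_prob :: "complex mat set \<Rightarrow> complex mat measure \<Rightarrow> bool" where
  "haar_prob K \<mu> \<longleftrightarrow> prob_space \<mu> \<and> sets \<mu> = sets (mat_borel K) \<and>
     (\<forall>g\<in>K. \<forall>E\<in>sets \<mu>. emeasure \<mu> ((\<lambda>x. g * x) ` E) = emeasure \<mu> E)"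

definition mat_conv ::
    "complex mat set \<Rightarrow> complex mat measure \<Rightarrow> complex mat measure \<Rightarrow> complex mat measure" where
  "mat_conv G \<mu> \<nu> = distr (\<mu> \<Otimes>\<^sub>M \<nu>) (mat_borel G) (\<lambda>(x, y). x * y)"

text \<open>
  \<open>\<tau>_meas \<alpha> k N \<kappa> g h\<close> is \<open>\<kappa> * \<delta>\<^sub>g * \<kappa> * \<delta>\<^sub>h * \<kappa>\<close>, where \<open>\<kappa>\<close> is a measure on the subgroup
  \<open>K\<close>, which is pushed forward to \<open>G\<close> along the inclusion.
\<close>

definition \<tau>_meas ::
    "nat \<Rightarrow> nat \<Rightarrow> nat \<Rightarrow> complex mat measure \<Rightarrow> complex mat \<Rightarrow> complex mat \<Rightarrow> complex mat measure"
  where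
  "\<tau>_meas \<alpha> k N \<kappa> g h =
     (let G = G_grp \<alpha> k N;
          \<kappa>G = distr \<kappa> (mat_borel G) (\<lambda>x. x);
          \<delta>g = return (mat_borel G) (embed_G \<alpha> k N g);
          \<delta>h = return (mat_borel G) (embed_G \<alpha> k N h)
      in mat_conv G (mat_conv G (mat_conv G (mat_conv G \<kappa>G \<delta>g) \<kappa>G) \<delta>h) \<kappa>G)"

end

theory Submission
  imports Defs
begin

text \<open>
  Why the theorem holds. Let \<open>S\<close> be the \<open>\<epsilon>\<close>-neighbourhood of the double coset \<open>K g J h K\<close>. It is invariant
  under \<open>K\<close> on both sides, because left and right multiplications by unitary matrices are isometries of
  the operator norm. Hence only the middle factor of the convolution matters:
  \<open>\<tau>(S) = \<kappa> {x \<in> K. g x h \<in> S}\<close> (\<open>emeasure_conv_bi_invariant\<close>). So it is enough to show that \<open>g x h\<close> lies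
  in \<open>S\<close> for most \<open>x\<close>, where \<open>x\<close> is a Haar random element of \<open>O(k + N)\<close>.
  
  Write \<open>x\<close> in blocks of sizes \<open>k + N\<close>. By symmetry each entry of \<open>x\<close> has second moment \<open>1 / (k + N)\<close>, so
  the corner of size \<open>k\<close> is small with probability close to one when \<open>N\<close> is large
  (\<open>haar_corner_concentration\<close>).
  
  A small corner forces \<open>x\<close> to be close to \<open>J\<close>, up to multiplication on both sides by the subgroup \<open>O(N)\<close>
  acting on the last \<open>N\<close> coordinates (\<open>near_J_real\<close>). Indeed the \<open>k\<close> columns of the lower left block are
  then almost orthonormal, so an element of \<open>O(N)\<close> carries them close to the first \<open>k\<close> unit vectors;
  the same applies to the rows of the upper right block. Orthogonality does the rest: after these
  multiplications \<open>x\<close> splits exactly into a block of size \<open>2k\<close>, close to the exchange of two groups of \<open>k\<close>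
  coordinates, and an element of \<open>O(N - k)\<close>, which can be removed. For the triangular normalisation of the
  almost orthonormal columns all estimates are explicit and depend only on \<open>k\<close>, not on \<open>N\<close>.
  
  Finally, the copy of \<open>O(N)\<close> in \<open>K\<close> commutes with \<open>U(\<alpha> + 2k)\<close> (\<open>embed_G_commute\<close>). Therefore the
  multiplications by \<open>O(N)\<close> can be pulled out of \<open>g x h\<close> to the outside, where they are absorbed by the
  double coset, and \<open>g x h\<close> is close to \<open>K g J h K\<close> (\<open>near_circ_coset\<close>).
\<close>

section \<open>Orthogonal groups and block sums\<close>

lemma orthogonal_group_carrier: "x \<in> orthogonal_group n \<Longrightarrow> x \<in> carrier_mat n n"
  by (simp add: orthogonal_group_def)

lemma orthogonal_group_left: 
  assumes "x \<in> orthogonal_group n" shows "transpose_mat x * x = 1\<^sub>m n"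
  using assms mat_mult_left_right_inverse[of x n "transpose_mat x"]
  by (simp add: orthogonal_group_def)

lemma orthogonal_group_transpose:
  assumes "x \<in> orthogonal_group n" shows "transpose_mat x \<in> orthogonal_group n"
  using orthogonal_group_left[OF assms] assms by (simp add: orthogonal_group_def)

lemma orthogonal_group_mult:
  assumes "x \<in> orthogonal_group n" "y \<in> orthogonal_group n"
  shows "x * y \<in> orthogonal_group n"
proof -
  note c = assms[THEN orthogonal_group_carrier]
  have "x * y * transpose_mat (x * y) = x * (y * transpose_mat y) * transpose_mat x"
    using c by (simp add: transpose_mult[of x n n y n] assoc_mult_mat[of _ n n _ n _ n])
  also have "\<dots> = x * transpose_mat x"
    using assms by (simp add: orthogonal_group_def right_mult_one_mat[of x n n])
  also have "\<dots> = 1\<^sub>m n" using assms by (simp add: orthogonal_group_def)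
  finally show ?thesis using c by (simp add: orthogonal_group_def)
qed

lemma orthogonal_group_one: "1\<^sub>m n \<in> orthogonal_group n"
  by (simp add: orthogonal_group_def)

lemma orthogonal_group_rows:
  assumes "x \<in> orthogonal_group n" "i < n" "j < n"
  shows "(\<Sum>l<n. x $$ (i, l) * x $$ (j, l)) = (if i = j then 1 else 0)"
proof -
  have "(x * transpose_mat x) $$ (i, j) = (if i = j then 1 else 0)"
    using assms by (simp add: orthogonal_group_def)
  then show ?thesis
    using assms orthogonal_group_carrier[OF assms(1)] by (simp add: scalar_prod_def lessThan_atLeast0)
qed

lemma orthogonal_group_cols:
  assumes "x \<in> orthogonal_group n" "i < n" "j < n"
  shows "(\<Sum>l<n. x $$ (l, i) * x $$ (l, j)) = (if i = j then 1 else 0)"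
  using orthogonal_group_rows[OF orthogonal_group_transpose[OF assms(1)] assms(2,3)]
    assms orthogonal_group_carrier[OF assms(1)] by simp

text \<open>
  Rectangular summands are allowed, because the off-diagonal blocks of a matrix of
  \<open>U(\<alpha> + 2k)\<close>, enlarged to size \<open>\<alpha> + 2(k + N)\<close>, are themselves sums of a rectangular block and a zero
  block.
\<close>

definition dsum :: "'a :: zero mat \<Rightarrow> 'a mat \<Rightarrow> 'a mat" (infixr "\<oplus>\<^sub>d" 65) where
  "A \<oplus>\<^sub>d B = four_block_mat A (0\<^sub>m (dim_row A) (dim_col B)) (0\<^sub>m (dim_row B) (dim_col A)) B"

lemma dsum_dim [simp]:
  "dim_row (A \<oplus>\<^sub>d B) = dim_row A + dim_row B" "dim_col (A \<oplus>\<^sub>d B) = dim_col A + dim_col B"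
  by (simp_all add: dsum_def)

lemma dsum_carrier [simp]:
  "A \<in> carrier_mat m n \<Longrightarrow> B \<in> carrier_mat m' n' \<Longrightarrow> A \<oplus>\<^sub>d B \<in> carrier_mat (m + m') (n + n')"
  by (rule carrier_matI) simp_all

lemma dsum_index:
  "i < dim_row A + dim_row B \<Longrightarrow> j < dim_col A + dim_col B \<Longrightarrow>
   (A \<oplus>\<^sub>d B) $$ (i, j) =
     (if i < dim_row A \<and> j < dim_col A then A $$ (i, j)
      else if dim_row A \<le> i \<and> dim_col A \<le> j then B $$ (i - dim_row A, j - dim_col A) else 0)"
  unfolding dsum_def by simp

lemma dsum_assoc: "A \<oplus>\<^sub>d (B \<oplus>\<^sub>d C) = (A \<oplus>\<^sub>d B) \<oplus>\<^sub>d C"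
  using assoc_four_block_mat[of A B C] unfolding dsum_def .

lemma dsum_one: "1\<^sub>m m \<oplus>\<^sub>d 1\<^sub>m n = 1\<^sub>m (m + n)"
  by (simp add: dsum_def)

lemma dsum_mult:
  assumes "A \<in> carrier_mat m n" "B \<in> carrier_mat m' n'" "A' \<in> carrier_mat n p" "B' \<in> carrier_mat n' p'"
  shows "(A \<oplus>\<^sub>d B) * (A' \<oplus>\<^sub>d B') = (A * A') \<oplus>\<^sub>d (B * (B' :: 'a :: comm_ring_1 mat))"
proof -
  have "(A \<oplus>\<^sub>d B) * (A' \<oplus>\<^sub>d B') =
    four_block_mat (A * A' + 0\<^sub>m m n' * 0\<^sub>m n' p) (A * 0\<^sub>m n p' + 0\<^sub>m m n' * B')
      (0\<^sub>m m' n * A' + B * 0\<^sub>m n' p) (0\<^sub>m m' n * 0\<^sub>m n p' + B * B')"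
    unfolding dsum_def using assms
    by (subst mult_four_block_mat[of _ m n _ n' _ m' _ _ p _ p']) simp_all
  also have "\<dots> = (A * A') \<oplus>\<^sub>d (B * B')"
    using assms by (simp add: dsum_def carrier_matD)
  finally show ?thesis .
qed

lemma dsum_transpose: "transpose_mat (A \<oplus>\<^sub>d B) = transpose_mat A \<oplus>\<^sub>d transpose_mat B"
  unfolding dsum_def
  by (subst transpose_four_block_mat[of _ "dim_row A" "dim_col A" _ "dim_col B" _ "dim_row B"]) auto

lemma orthogonal_group_dsum:
  assumes "x \<in> orthogonal_group m" "y \<in> orthogonal_group n"
  shows "x \<oplus>\<^sub>d y \<in> orthogonal_group (m + n)"
  using assms by (auto simp: orthogonal_group_def dsum_transpose dsum_mult[of _ m m _ n n] dsum_one)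

lemma orthogonal_group_dsum_right:
  assumes "x \<oplus>\<^sub>d y \<in> orthogonal_group (m + n)" "x \<in> carrier_mat m m" "y \<in> carrier_mat n n"
  shows "y \<in> orthogonal_group n"
proof -
  have e: "(x * transpose_mat x) \<oplus>\<^sub>d (y * transpose_mat y) = 1\<^sub>m (m + n)"
    using assms by (auto simp: orthogonal_group_def dsum_transpose dsum_mult[of _ m m _ n n])
  have "y * transpose_mat y = 1\<^sub>m n"
  proof (rule eq_matI)
    fix i j assume ij: "i < dim_row (1\<^sub>m n)" "j < dim_col (1\<^sub>m n)"
    have "((x * transpose_mat x) \<oplus>\<^sub>d (y * transpose_mat y)) $$ (m + i, m + j) 
      = (y * transpose_mat y) $$ (i, j)"
      using ij assms(2,3) by (subst dsum_index) auto
    then show "(y * transpose_mat y) $$ (i, j) = 1\<^sub>m n $$ (i, j)" using ij unfolding e by simp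
  qed (use assms in auto)
  then show ?thesis using assms by (simp add: orthogonal_group_def)
qed

section \<open>Triangular form by reflections\<close>

text \<open>
  Unless \<open>c = \<bar>c\<bar> e\<^sub>0\<close> already, the matrix is the Householder reflection in the hyperplane orthogonal
  to \<open>u = c - \<bar>c\<bar> e\<^sub>0\<close>. The
  vectors \<open>c\<close> and \<open>\<bar>c\<bar> e\<^sub>0\<close> have the same length, so this hyperplane bisects them and the reflection
  exchanges them; algebraically this is the identity \<open>\<bar>u\<bar>\<^sup>2 = 2 \<langle>u, c\<rangle>\<close>.
\<close>

lemma reflection_onto_first_axis:
  fixes c :: "nat \<Rightarrow> real"
  assumes "0 < n"
  obtains H where "H \<in> orthogonal_group n"
    and "\<And>i. i < n \<Longrightarrow> (\<Sum>l<n. H $$ (i, l) * c l) = (if i = 0 then L2_set c {..<n} else 0)"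
proof -
  define r where "r = L2_set c {..<n}"
  have r2: "r\<^sup>2 = (\<Sum>i<n. (c i)\<^sup>2)" unfolding r_def L2_set_def by (simp add: sum_nonneg)
  define u where "u i = c i - (if i = 0 then r else 0)" for i
  define U where "U = (\<Sum>i<n. (u i)\<^sup>2)"
  have U: "U = 2 * (\<Sum>i<n. u i * c i)"
  proof -
    have s: "(\<Sum>i<n. (if i = 0 then r else 0) * c i) = r * c 0"
      using assms by (simp add: if_distrib[of "\<lambda>x. x * _"] cong: if_cong)
    have s2: "(\<Sum>i<n. (if i = 0 then r else 0)\<^sup>2) = r\<^sup>2"
      using assms by (simp add: if_distrib[of "\<lambda>x. x ^ 2"] cong: if_cong)
    have "U = (\<Sum>i<n. (c i)\<^sup>2) - 2 * (r * c 0) + r\<^sup>2"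
      unfolding U_def u_def s[symmetric] s2[symmetric] sum_distrib_left sum_subtractf[symmetric] sum.distrib[symmetric]
      by (intro sum.cong) (auto simp: power2_eq_square algebra_simps)
    moreover have "(\<Sum>i<n. u i * c i) = (\<Sum>i<n. (c i)\<^sup>2) - r * c 0"
      unfolding u_def s[symmetric] sum_subtractf[symmetric]
      by (intro sum.cong) (auto simp: power2_eq_square algebra_simps)
    ultimately show ?thesis using r2 by simp
  qed
  show ?thesis
  proof (cases "U = 0")
    case True
    then have u0: "u i = 0" if "i < n" for i
      using that unfolding U_def by (subst (asm) sum_nonneg_eq_0_iff) auto
    show ?thesis
    proof (rule that[of "1\<^sub>m n"])
      fix i assume i: "i < n"
      have "(\<Sum>l<n. 1\<^sub>m n $$ (i, l) * c l) = (\<Sum>l<n. if l = i then c l else 0)"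
        using i by (intro sum.cong) auto
      then show "(\<Sum>l<n. 1\<^sub>m n $$ (i, l) * c l) = (if i = 0 then L2_set c {..<n} else 0)"
        using i u0[OF i] by (auto simp: u_def r_def)
    qed (rule orthogonal_group_one)
  next
    case False
    define t where "t = 2 / U"
    define H where "H = mat n n (\<lambda>(i, j). (if i = j then 1 else 0) - t * u i * u j)"
    have Hi: "H $$ (i, j) = (if i = j then 1 else 0) - t * u i * u j" if "i < n" "j < n" for i j
      using that by (simp add: H_def)
    have act: "(\<Sum>l<n. H $$ (i, l) * f l) = f i - t * u i * (\<Sum>l<n. u l * f l)" if "i < n" for i f
    proof -
      have "(\<Sum>l<n. H $$ (i, l) * f l) = (\<Sum>l<n. (if l = i then f l else 0) - t * u i * (u l * f l))"
        using that by (intro sum.cong) (auto simp: Hi algebra_simps)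
      also have "\<dots> = f i - t * u i * (\<Sum>l<n. u l * f l)"
        using that by (simp add: sum_subtractf sum_distrib_left)
      finally show ?thesis .
    qed
    have "H * transpose_mat H = 1\<^sub>m n"
    proof (rule eq_matI)
      fix i j assume ij: "i < dim_row (1\<^sub>m n)" "j < dim_col (1\<^sub>m n)"
      have "(H * transpose_mat H) $$ (i, j) = (\<Sum>l<n. H $$ (i, l) * H $$ (j, l))"
        using ij by (simp add: H_def scalar_prod_def lessThan_atLeast0)
      also have "\<dots> = H $$ (j, i) - t * u i * (\<Sum>l<n. u l * H $$ (j, l))"
        using ij by (simp add: act)
      also have "(\<Sum>l<n. u l * H $$ (j, l)) = u j - t * u j * U"
        using act[of j u] ij by (simp add: U_def power2_eq_square mult.commute)
      also have "H $$ (j, i) - t * u i * (u j - t * u j * U) = (if i = j then 1 else 0)"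
        using ij False by (simp add: Hi t_def field_simps)
      finally show "(H * transpose_mat H) $$ (i, j) = 1\<^sub>m n $$ (i, j)" using ij by simp
    qed (auto simp: H_def)
    then have "H \<in> orthogonal_group n" by (simp add: orthogonal_group_def H_def)
    moreover have "(\<Sum>l<n. H $$ (i, l) * c l) = (if i = 0 then L2_set c {..<n} else 0)" if "i < n" for i
    proof -
      have "t * (\<Sum>l<n. u l * c l) = 1" using U False by (simp add: t_def)
      then have "(\<Sum>l<n. H $$ (i, l) * c l) = c i - u i" 
        using act[OF that, of c] by (simp add: mult.assoc mult.left_commute)
      then show ?thesis by (simp add: u_def r_def)
    qed
    ultimately show ?thesis by (rule that)
  qed
qed

text \<open>
  The QR decomposition, for a tall matrix: a reflection sends the first column to a nonnegative
  multiple of \<open>e\<^sub>0\<close>, and the remaining columns without their first entries are treated by induction.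
  The sign of the diagonal is normalised because only then does an almost isometric triangular matrix
  have to be close to the identity.
\<close>

lemma orthogonal_triangularization:
  fixes M :: "real mat"
  assumes "M \<in> carrier_mat N k" "k \<le> N"
  shows "\<exists>y \<in> orthogonal_group N. (\<forall>j<k. 0 \<le> (y * M) $$ (j, j)) \<and>
           (\<forall>i<N. \<forall>j<k. j < i \<longrightarrow> (y * M) $$ (i, j) = 0)"
  using assms
proof (induction k arbitrary: N M)
  case 0
  show ?case by (rule bexI[OF _ orthogonal_group_one]) simp
next
  case (Suc k)
  obtain N' where N: "N = 1 + N'" using Suc.prems by (cases N) auto
  obtain H where H: "H \<in> orthogonal_group N"
    and HM: "\<And>i. i < N \<Longrightarrow> (\<Sum>l<N. H $$ (i, l) * M $$ (l, 0)) 
              = (if i = 0 then L2_set (\<lambda>l. M $$ (l, 0)) {..<N} else 0)"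
    by (rule reflection_onto_first_axis[of N "\<lambda>l. M $$ (l, 0)"]) (auto simp: N)
  note Hc = orthogonal_group_carrier[OF H]
  have HM0: "(H * M) $$ (i, 0) = (if i = 0 then L2_set (\<lambda>l. M $$ (l, 0)) {..<N} else 0)" if "i < N" for i
    using HM[OF that] that Hc Suc.prems by (simp add: scalar_prod_def lessThan_atLeast0)
  obtain A B C D where sp: "split_block (H * M) 1 1 = (A, B, C, D)" by (metis prod_cases4)
  have c: "A \<in> carrier_mat 1 1" "B \<in> carrier_mat 1 k" "C \<in> carrier_mat N' 1" "D \<in> carrier_mat N' k"
    and HMb: "H * M = four_block_mat A B C D"
    using split_block[OF sp, of N' k] Hc Suc.prems N by auto
  obtain y where y: "y \<in> orthogonal_group N'" "\<forall>j<k. 0 \<le> (y * D) $$ (j, j)" 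
     "\<forall>i<N'. \<forall>j<k. j < i \<longrightarrow> (y * D) $$ (i, j) = 0"
    using Suc.IH[OF c(4)] Suc.prems N by auto
  note yc = orthogonal_group_carrier[OF y(1)]
  have C0: "C = 0\<^sub>m N' 1"
  proof (rule eq_matI)
    fix i j assume "i < dim_row (0\<^sub>m N' 1)" "j < dim_col (0\<^sub>m N' 1)"
    then show "C $$ (i, j) = 0\<^sub>m N' 1 $$ (i, j)"
      using HM0[of "Suc i"] c unfolding HMb by (simp add: N)
  qed (use c in auto)
  have A0: "0 \<le> A $$ (0, 0)"
    using HM0[of 0] c N by (simp add: HMb L2_set_nonneg)
  have Y: "1\<^sub>m 1 \<oplus>\<^sub>d y \<in> orthogonal_group N"
    unfolding N by (intro orthogonal_group_dsum orthogonal_group_one y)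
  have "(1\<^sub>m 1 \<oplus>\<^sub>d y) * H * M = (1\<^sub>m 1 \<oplus>\<^sub>d y) * (H * M)"
    using Hc Suc.prems orthogonal_group_carrier[OF Y] by (intro assoc_mult_mat) auto
  also have "\<dots> = four_block_mat A B (0\<^sub>m N' 1) (y * D)"
    unfolding HMb dsum_def using c yc by (subst mult_four_block_mat[of _ 1 1 _ N' _ N' _ _ 1 _ k]) (auto simp: C0)
  finally have e: "(1\<^sub>m 1 \<oplus>\<^sub>d y) * H * M = four_block_mat A B (0\<^sub>m N' 1) (y * D)" .
  show ?case
  proof (rule bexI[of _ "(1\<^sub>m 1 \<oplus>\<^sub>d y) * H"], unfold e, intro conjI allI impI)
    fix j assume "j < Suc k"
    then show "0 \<le> four_block_mat A B (0\<^sub>m N' 1) (y * D) $$ (j, j)"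
      using A0 c yc y(2) Suc.prems(2) N by (cases j) auto
  next
    fix i j assume "i < N" "j < Suc k" "j < i"
    then show "four_block_mat A B (0\<^sub>m N' 1) (y * D) $$ (i, j) = 0"
      using c yc y(3) N by (cases i; cases j) auto
  qed (rule orthogonal_group_mult[OF Y H])
qed

text \<open>
  An upper triangular matrix with nonnegative diagonal and orthonormal columns is the identity; this is
  the stable form of that fact, proved along the rows from the top. Row \<open>i\<close> of the Gram matrix is
  \<open>r\<^sub>i\<^sub>i r\<^sub>i\<^sub>j\<close> plus products of two off-diagonal entries from earlier rows. By induction these products
  are at most \<open>16 \<eta>\<^sup>2\<close>, so together they contribute at most \<open>\<eta>\<close> as soon as \<open>16 k \<eta> \<le> 1\<close>. In this way
  the error bound \<open>4 \<eta>\<close> does not grow from row to row.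
\<close>

lemma near_identity_triangular:
  fixes r :: "nat \<Rightarrow> nat \<Rightarrow> real"
  assumes tri: "\<And>i j. i < k \<Longrightarrow> j < i \<Longrightarrow> r i j = 0" and pos: "\<And>i. i < k \<Longrightarrow> 0 \<le> r i i"
    and gram: "\<And>i j. i < k \<Longrightarrow> j < k \<Longrightarrow> \<bar>(\<Sum>l<k. r l i * r l j) - (if i = j then 1 else 0)\<bar> \<le> \<eta>"
    and small: "16 * real k * \<eta> \<le> 1"
    and "i < k" "j < k"
  shows "\<bar>r i j - (if i = j then 1 else 0)\<bar> \<le> 4 * \<eta>"
  using \<open>i < k\<close> \<open>j < k\<close>
proof (induction i arbitrary: j rule: less_induct)
  case (less i)
  have \<eta>0: "0 \<le> \<eta>" using gram[OF less.prems] by linarith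
  have \<eta>16: "16 * \<eta> \<le> 1"
  proof -
    have "1 * \<eta> \<le> real k * \<eta>" using \<eta>0 less.prems by (intro mult_right_mono) auto
    then show ?thesis using small by linarith
  qed
  have main: "\<bar>r i i * r i j - (if i = j then 1 else 0)\<bar> \<le> 2 * \<eta>" if j: "i \<le> j" "j < k" for j
  proof -
    have split: "(\<Sum>l<k. r l i * r l j) = (\<Sum>l<i. r l i * r l j) + r i i * r i j"
    proof -
      have "(\<Sum>l<k. r l i * r l j) = (\<Sum>l<Suc i. r l i * r l j)"
        using less.prems by (intro sum.mono_neutral_right) (auto simp: tri)
      then show ?thesis by simp
    qed
    have "\<bar>\<Sum>l<i. r l i * r l j\<bar> \<le> (\<Sum>l<i. \<bar>r l i * r l j\<bar>)" by (rule sum_abs)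
    also have "\<dots> \<le> (\<Sum>l<i. (4 * \<eta>) * (4 * \<eta>))"
    proof (rule sum_mono)
      fix l assume "l \<in> {..<i}"
      then have "\<bar>r l i\<bar> \<le> 4 * \<eta>" "\<bar>r l j\<bar> \<le> 4 * \<eta>"
        using less.IH[of l i] less.IH[of l j] less.prems j by auto
      then show "\<bar>r l i * r l j\<bar> \<le> (4 * \<eta>) * (4 * \<eta>)"
        unfolding abs_mult using \<eta>0 by (intro mult_mono) auto
    qed
    also have "\<dots> \<le> (16 * real k * \<eta>) * \<eta>"
    proof -
      have "real i * \<eta>\<^sup>2 \<le> real k * \<eta>\<^sup>2" using less.prems by (intro mult_right_mono) auto
      then show ?thesis by (simp add: power2_eq_square algebra_simps)
    qed
    also have "\<dots> \<le> 1 * \<eta>" using small \<eta>0 by (intro mult_right_mono) auto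
    finally show ?thesis using gram[of i j] less.prems j unfolding split by linarith
  qed
  have d: "\<bar>r i i * r i i - 1\<bar> \<le> 2 * \<eta>" using main[of i] less.prems by simp
  have ri: "0 \<le> r i i" using pos less.prems by simp
  have d1: "\<bar>r i i - 1\<bar> \<le> 2 * \<eta>"
  proof -
    have "\<bar>r i i - 1\<bar> * 1 \<le> \<bar>r i i - 1\<bar> * \<bar>r i i + 1\<bar>"
      using ri by (intro mult_left_mono) auto
    also have "\<dots> = \<bar>r i i * r i i - 1\<bar>" by (simp add: abs_mult[symmetric] algebra_simps)
    finally show ?thesis using d by simp
  qed
  consider "j < i" | "j = i" | "i < j" by linarith
  then show ?case
  proof cases
    case 3
    have "1 / 2 \<le> r i i" using d1 \<eta>16 by linarith
    then have "(1 / 2) * \<bar>r i j\<bar> \<le> r i i * \<bar>r i j\<bar>" by (intro mult_right_mono) auto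
    also have "\<dots> \<le> 2 * \<eta>" using main[of j] 3 less.prems ri by (simp add: abs_mult)
    finally show ?thesis using 3 by simp
  qed (use tri[of i j] less.prems \<eta>0 d1 in auto)
qed

section \<open>Orthogonal matrices with a small corner\<close>

lemma sum_lessThan_add:
  fixes k N :: nat
  shows "(\<Sum>l<k + N. f l) = (\<Sum>l<k. f l) + (\<Sum>l<N. f (k + l) :: 'a :: comm_monoid_add)"
  by (induction N) (simp_all add: add.assoc)

text \<open>
  An orthogonal matrix in blocks of sizes \<open>k + N\<close>, with a small upper left corner, whose lower left block
  has been brought to triangular form. In the application both the matrix and its transpose have this
  form, which gives the statements about its upper right block.
\<close>

locale triangular_corner =
  fixes k N :: nat and X :: "real mat" and \<eta> :: real
  assumes X: "X \<in> orthogonal_group (k + N)" and kN: "k \<le> N"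
    and tri: "\<And>i j. i < N \<Longrightarrow> j < k \<Longrightarrow> j < i \<Longrightarrow> X $$ (k + i, j) = 0"
    and pos: "\<And>j. j < k \<Longrightarrow> 0 \<le> X $$ (k + j, j)"
    and corner: "(\<Sum>i<k. \<Sum>j<k. (X $$ (i, j))\<^sup>2) \<le> \<eta>"
    and small: "16 * real k * \<eta> \<le> 1"
begin

lemma cols_inner:
  assumes "i < k" "j < k + N"
  shows "(\<Sum>l<k. X $$ (l, i) * X $$ (l, j)) + (\<Sum>l<k. X $$ (k + l, i) * X $$ (k + l, j))
    = (if i = j then 1 else 0)"
proof -
  have "(\<Sum>l<N. X $$ (k + l, i) * X $$ (k + l, j)) = (\<Sum>l<k. X $$ (k + l, i) * X $$ (k + l, j))"
    using kN assms by (intro sum.mono_neutral_right) (auto simp: tri)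
  then show ?thesis
    using orthogonal_group_cols[OF X, of i j] assms by (simp add: sum_lessThan_add)
qed

text \<open>
  The Gram matrix of the triangular block is \<open>1 - a\<^sup>T a\<close>, where \<open>a\<close> is the corner, and the entries of
  \<open>a\<^sup>T a\<close> are bounded by the sum of the squares of the entries of \<open>a\<close>.
\<close>

lemma near_one:
  assumes "i < k" "j < k"
  shows "\<bar>X $$ (k + i, j) - (if i = j then 1 else 0)\<bar> \<le> 4 * \<eta>"
proof (rule near_identity_triangular[where k = k])
  fix i j assume ij: "i < k" "j < k"
  have col: "(\<Sum>l<k. (X $$ (l, j))\<^sup>2) \<le> \<eta>" if "j < k" for j
  proof -
    have "(\<Sum>l<k. (X $$ (l, j))\<^sup>2) \<le> (\<Sum>l<k. \<Sum>j<k. (X $$ (l, j))\<^sup>2)"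
      using that by (intro sum_mono member_le_sum) auto
    then show ?thesis using corner by simp
  qed
  have "\<bar>\<Sum>l<k. X $$ (l, i) * X $$ (l, j)\<bar> \<le> (\<Sum>l<k. \<bar>X $$ (l, i) * X $$ (l, j)\<bar>)"
    by (rule sum_abs)
  also have "\<dots> \<le> (\<Sum>l<k. ((X $$ (l, i))\<^sup>2 + (X $$ (l, j))\<^sup>2) / 2)"
  proof (rule sum_mono)
    fix l
    show "\<bar>X $$ (l, i) * X $$ (l, j)\<bar> \<le> ((X $$ (l, i))\<^sup>2 + (X $$ (l, j))\<^sup>2) / 2"
      using sum_squares_bound[of "\<bar>X $$ (l, i)\<bar>" "\<bar>X $$ (l, j)\<bar>"] by (simp add: abs_mult)
  qed
  also have "\<dots> = ((\<Sum>l<k. (X $$ (l, i))\<^sup>2) + (\<Sum>l<k. (X $$ (l, j))\<^sup>2)) / 2"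
    by (simp add: sum.distrib sum_divide_distrib[symmetric])
  also have "\<dots> \<le> \<eta>" using col[OF ij(1)] col[OF ij(2)] by simp
  finally show "\<bar>(\<Sum>l<k. X $$ (k + l, i) * X $$ (k + l, j)) - (if i = j then 1 else 0)\<bar> \<le> \<eta>"
    using cols_inner[of i j] ij by linarith
qed (use assms kN small in \<open>auto intro: tri pos\<close>)

lemma diag_pos: "i < k \<Longrightarrow> 0 < X $$ (k + i, i)"
proof -
  assume i: "i < k"
  have \<eta>0: "0 \<le> \<eta>" using near_one[OF i i] by linarith
  have "1 * \<eta> \<le> real k * \<eta>" using \<eta>0 i by (intro mult_right_mono) auto
  then show ?thesis using small near_one[OF i i] by simp
qed

text \<open>
  A later column that vanishes on the first \<open>k\<close> rows is orthogonal to the first \<open>k\<close> columns, which on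
  the remaining rows form a triangular matrix with positive diagonal; forward substitution gives zero
  for its next \<open>k\<close> entries.
\<close>

lemma col_vanish:
  assumes "i < k" "k \<le> j" "j < k + N" and top: "\<And>l. l < k \<Longrightarrow> X $$ (l, j) = 0"
  shows "X $$ (k + i, j) = 0"
  using \<open>i < k\<close>
proof (induction i rule: less_induct)
  case (less i)
  have "0 = (\<Sum>l<k. X $$ (k + l, i) * X $$ (k + l, j))"
    using cols_inner[of i j] less.prems assms by (simp add: top)
  also have "\<dots> = (\<Sum>l\<in>{i}. X $$ (k + l, i) * X $$ (k + l, j))"
  proof (rule sum.mono_neutral_right)
    show "\<forall>l\<in>{..<k} - {i}. X $$ (k + l, i) * X $$ (k + l, j) = 0"
    proof
      fix l assume "l \<in> {..<k} - {i}"
      then consider "l < i" | "i < l" "l < k" using less.prems by fastforce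
      then show "X $$ (k + l, i) * X $$ (k + l, j) = 0"
        by cases (use less tri[of l i] kN in auto)
    qed
  qed (use less.prems in auto)
  finally show ?case using diag_pos[OF less.prems] by simp
qed

end

text \<open>
  The element of \<open>O(k + N)\<close> whose image in \<open>K\<^sub>N\<close> is \<open>J\<^sub>N\<close>.
\<close>

definition J_real :: "nat \<Rightarrow> nat \<Rightarrow> real mat" where
  "J_real k N = four_block_mat (0\<^sub>m k k) (1\<^sub>m k) (1\<^sub>m k) (0\<^sub>m k k) \<oplus>\<^sub>d 1\<^sub>m (N - k)"

lemma J_real_orthogonal:
  assumes "k \<le> N" shows "J_real k N \<in> orthogonal_group (k + N)"
proof -
  have "four_block_mat (0\<^sub>m k k) (1\<^sub>m k) (1\<^sub>m k) (0\<^sub>m k k) \<in> orthogonal_group (k + k)"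
    unfolding orthogonal_group_def
    by (simp add: transpose_four_block_mat[of _ k k _ k _ k] mult_four_block_mat[of _ k k _ k _ k _ _ k _ k])
  then have "J_real k N \<in> orthogonal_group (k + k + (N - k))"
    unfolding J_real_def by (intro orthogonal_group_dsum orthogonal_group_one)
  moreover have "k + k + (N - k) = k + N" using assms by simp
  ultimately show ?thesis by metis
qed

lemma dsum_index_outside:
  assumes "A \<in> carrier_mat m n" "\<not> (i < m \<and> j < n)" "i < m + dim_row B" "j < n + dim_col B"
  shows "(A \<oplus>\<^sub>d B) $$ (i, j) = (if m \<le> i \<and> n \<le> j then B $$ (i - m, j - n) else 0)"
proof -
  have "dim_row A = m" "dim_col A = n" using assms(1) by auto
  then show ?thesis using assms(2-) dsum_index[of i A B j] by presburger
qed

text \<open>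
  The geometric core. Multiplying from the left and from the right by \<open>O(N)\<close> makes the lower left block
  and the transpose of the upper right block triangular, hence close to the identity. Orthogonality of
  the rows and of the columns then decouples the first \<open>2k\<close> coordinates exactly from the last
  \<open>N - k\<close> ones, and the orthogonal matrix \<open>Q\<close> on the latter is absorbed by one more right factor from
  \<open>O(N)\<close>. What remains differs from \<open>J\<close> only in a block of size \<open>2k\<close>, by an amount that does not depend
  on \<open>N\<close>; this uniformity is what makes the theorem true for all large \<open>N\<close>.
\<close>

lemma near_J_real:
  assumes x: "x \<in> orthogonal_group (k + N)" and kN: "k \<le> N"
    and corner: "(\<Sum>i<k. \<Sum>j<k. (x $$ (i, j))\<^sup>2) \<le> \<eta>"
    and small: "16 * real k * \<eta> \<le> 1"
  obtains y z where "y \<in> orthogonal_group N" "z \<in> orthogonal_group N"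
    and "\<And>i j. i < k + N \<Longrightarrow> j < k + N \<Longrightarrow>
      \<bar>((1\<^sub>m k \<oplus>\<^sub>d y) * x * (1\<^sub>m k \<oplus>\<^sub>d z)) $$ (i, j) - J_real k N $$ (i, j)\<bar>
        \<le> (if i < 2 * k \<and> j < 2 * k then 3 * sqrt \<eta> else 0)"
proof -
  note xc = orthogonal_group_carrier[OF x]
  obtain a b c d where sp: "split_block x k k = (a, b, c, d)" by (metis prod_cases4)
  have cc: "a \<in> carrier_mat k k" "b \<in> carrier_mat k N" "c \<in> carrier_mat N k" "d \<in> carrier_mat N N"
    and xb: "x = four_block_mat a b c d"
    using split_block[OF sp, of N N] xc by auto
  obtain y where y: "y \<in> orthogonal_group N" "\<forall>j<k. 0 \<le> (y * c) $$ (j, j)"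
      "\<forall>i<N. \<forall>j<k. j < i \<longrightarrow> (y * c) $$ (i, j) = 0"
    using orthogonal_triangularization[OF cc(3) kN] by blast
  obtain w where w: "w \<in> orthogonal_group N" "\<forall>j<k. 0 \<le> (w * transpose_mat b) $$ (j, j)"
      "\<forall>i<N. \<forall>j<k. j < i \<longrightarrow> (w * transpose_mat b) $$ (i, j) = 0"
    using orthogonal_triangularization[of "transpose_mat b" N k] cc kN by auto
  note yc = orthogonal_group_carrier[OF y(1)] and wc = orthogonal_group_carrier[OF w(1)]
  define X where "X = (1\<^sub>m k \<oplus>\<^sub>d y) * x * (1\<^sub>m k \<oplus>\<^sub>d transpose_mat w)"
  have Y: "1\<^sub>m k \<oplus>\<^sub>d y \<in> orthogonal_group (k + N)"
    by (intro orthogonal_group_dsum orthogonal_group_one y)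
  have W: "1\<^sub>m k \<oplus>\<^sub>d transpose_mat w \<in> orthogonal_group (k + N)"
    by (intro orthogonal_group_dsum orthogonal_group_one orthogonal_group_transpose w)
  have X: "X \<in> orthogonal_group (k + N)"
    unfolding X_def by (intro orthogonal_group_mult x Y W)
  note Xc = orthogonal_group_carrier[OF X]
  have "(1\<^sub>m k \<oplus>\<^sub>d y) * x = four_block_mat a b (y * c) (y * d)"
    unfolding xb dsum_def using cc yc by (subst mult_four_block_mat[of _ k k _ N _ N _ _ k _ N]) auto
  then have "X = four_block_mat a b (y * c) (y * d) * (1\<^sub>m k \<oplus>\<^sub>d transpose_mat w)"
    by (simp add: X_def)
  also have "\<dots> = four_block_mat a (b * transpose_mat w) (y * c) (y * d * transpose_mat w)"
    unfolding dsum_def using cc yc wc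
    by (subst mult_four_block_mat[of _ k k _ N _ N _ _ k _ N]) auto
  finally have Xb: "X = four_block_mat a (b * transpose_mat w) (y * c) (y * d * transpose_mat w)" .
  have bw: "b * transpose_mat w = transpose_mat (w * transpose_mat b)"
    using cc wc by (simp add: transpose_mult[of w N N "transpose_mat b" k])
  have X11: "X $$ (i, j) = x $$ (i, j)" if "i < k" "j < k" for i j
    unfolding Xb xb using that cc yc wc by simp
  have X21: "X $$ (k + i, j) = (y * c) $$ (i, j)" if "i < N" "j < k" for i j
    unfolding Xb using that cc yc wc by simp
  have X12: "X $$ (j, k + i) = (w * transpose_mat b) $$ (i, j)" if "i < N" "j < k" for i j
    unfolding Xb bw using that cc yc wc by simp
  have cor: "(\<Sum>i<k. \<Sum>j<k. (X $$ (i, j))\<^sup>2) \<le> \<eta>" using corner by (simp add: X11)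
  interpret L: triangular_corner k N X \<eta>
    using X kN y cor small by unfold_locales (auto simp: X21)
  interpret R: triangular_corner k N "transpose_mat X" \<eta>
  proof unfold_locales
    show "(\<Sum>i<k. \<Sum>j<k. (transpose_mat X $$ (i, j))\<^sup>2) \<le> \<eta>"
      using cor Xc by (subst sum.swap) simp
  qed (use X orthogonal_group_transpose[OF X] kN w Xc X12 small in auto)
  have topright: "X $$ (i, j) = 0" if "i < 2 * k" "2 * k \<le> j" "j < k + N" for i j
  proof -
    have z: "X $$ (i, j) = 0" if i: "i < k" for i
    proof -
      have "j = k + (j - k)" using \<open>2 * k \<le> j\<close> by simp
      then show ?thesis using X12[of "j - k" i] i w(3) \<open>2 * k \<le> j\<close> \<open>j < k + N\<close> by auto
    qed
    show ?thesis
    proof (cases "i < k")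
      case False
      then show ?thesis using L.col_vanish[of "i - k" j] that z by simp
    qed (rule z)
  qed
  have bottomleft: "X $$ (j, i) = 0" if "i < 2 * k" "2 * k \<le> j" "j < k + N" for i j
  proof -
    have z: "X $$ (j, i) = 0" if i: "i < k" for i
    proof -
      have "j = k + (j - k)" using \<open>2 * k \<le> j\<close> by simp
      then show ?thesis using X21[of "j - k" i] i y(3) \<open>2 * k \<le> j\<close> \<open>j < k + N\<close> by auto
    qed
    show ?thesis
    proof (cases "i < k")
      case False
      then show ?thesis using R.col_vanish[of "i - k" j] that z Xc kN by simp
    qed (rule z)
  qed
  \<comment> \<open>The first \<open>2k\<close> coordinates decouple from the others.\<close>
  define P where "P = mat (2 * k) (2 * k) (\<lambda>ij. X $$ ij)"
  define Q where "Q = mat (N - k) (N - k) (\<lambda>(i, j). X $$ (2 * k + i, 2 * k + j))"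
  have [simp]: "P \<in> carrier_mat (2 * k) (2 * k)" "Q \<in> carrier_mat (N - k) (N - k)"
    by (simp_all add: P_def Q_def)
  have n: "2 * k + (N - k) = k + N" using kN by simp
  have PQ: "X = P \<oplus>\<^sub>d Q"
  proof (rule eq_matI)
    fix i j assume "i < dim_row (P \<oplus>\<^sub>d Q)" "j < dim_col (P \<oplus>\<^sub>d Q)"
    then show "X $$ (i, j) = (P \<oplus>\<^sub>d Q) $$ (i, j)"
      using topright[of i j] bottomleft[of j i] by (subst dsum_index) (auto simp: P_def Q_def n)
  qed (use Xc n in \<open>auto simp: P_def Q_def\<close>)
  have Q: "Q \<in> orthogonal_group (N - k)"
    by (rule orthogonal_group_dsum_right[of P _ "2 * k"]) (use X PQ n in auto)
  define z where "z = transpose_mat w * (1\<^sub>m k \<oplus>\<^sub>d transpose_mat Q)"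
  have "1\<^sub>m k \<oplus>\<^sub>d transpose_mat Q \<in> orthogonal_group (k + (N - k))"
    by (intro orthogonal_group_dsum orthogonal_group_one orthogonal_group_transpose Q)
  then have oQ: "1\<^sub>m k \<oplus>\<^sub>d transpose_mat Q \<in> orthogonal_group N" using kN by simp
  have z: "z \<in> orthogonal_group N"
    unfolding z_def by (intro orthogonal_group_mult orthogonal_group_transpose w oQ)
  have "(1\<^sub>m k \<oplus>\<^sub>d z) = (1\<^sub>m k \<oplus>\<^sub>d transpose_mat w) * (1\<^sub>m k \<oplus>\<^sub>d (1\<^sub>m k \<oplus>\<^sub>d transpose_mat Q))"
    unfolding z_def using wc orthogonal_group_carrier[OF oQ] 
    by (subst dsum_mult[of _ k k _ N N _ k _ N]) auto
  then have "(1\<^sub>m k \<oplus>\<^sub>d y) * x * (1\<^sub>m k \<oplus>\<^sub>d z) = X * (1\<^sub>m k \<oplus>\<^sub>d (1\<^sub>m k \<oplus>\<^sub>d transpose_mat Q))"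
    unfolding X_def using orthogonal_group_carrier[OF Y] orthogonal_group_carrier[OF W] xc
      orthogonal_group_carrier[OF oQ]
    by (simp add: assoc_mult_mat[of _ "k + N" "k + N" _ "k + N" _ "k + N"])
  also have "\<dots> = (P \<oplus>\<^sub>d Q) * (1\<^sub>m (2 * k) \<oplus>\<^sub>d transpose_mat Q)"
    by (simp add: PQ dsum_assoc dsum_one mult_2)
  also have "\<dots> = P \<oplus>\<^sub>d 1\<^sub>m (N - k)"
    using Q by (subst dsum_mult[of _ "2 * k" "2 * k" _ "N - k" "N - k" _ "2 * k" _ "N - k"])
      (auto simp: orthogonal_group_def right_mult_one_mat[of P "2 * k" "2 * k"])
  finally have F: "(1\<^sub>m k \<oplus>\<^sub>d y) * x * (1\<^sub>m k \<oplus>\<^sub>d z) = P \<oplus>\<^sub>d 1\<^sub>m (N - k)" .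
  have est: "\<bar>X $$ (i, j) - J_real k N $$ (i, j)\<bar> \<le> 3 * sqrt \<eta>" if ij: "i < 2 * k" "j < 2 * k" for i j
  proof -
    have k0: "0 < k" using ij by simp
    have \<eta>0: "0 \<le> \<eta>" using L.near_one[OF k0 k0] by linarith
    have "1 * \<eta> \<le> real k * \<eta>" using \<eta>0 k0 by (intro mult_right_mono) auto
    then have \<eta>16: "16 * \<eta> \<le> 1" using small by simp
    have s4: "4 * \<eta> \<le> sqrt \<eta>"
    proof (rule real_le_rsqrt)
      have "16 * \<eta> * \<eta> \<le> 1 * \<eta>" using \<eta>16 \<eta>0 by (intro mult_right_mono) auto
      then show "(4 * \<eta>)\<^sup>2 \<le> \<eta>" by (simp add: power2_eq_square)
    qed
    have J: "J_real k N $$ (i, j) = (if i = k + j \<or> j = k + i then 1 else 0)"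
      using ij kN unfolding J_real_def by (subst dsum_index) auto
    consider "i < k" "j < k" | "k \<le> i" "j < k" | "i < k" "k \<le> j" | "k \<le> i" "k \<le> j" by linarith
    then show ?thesis
    proof cases
      case 1
      have "(X $$ (i, j))\<^sup>2 \<le> (\<Sum>j<k. (X $$ (i, j))\<^sup>2)" using 1 by (intro member_le_sum) auto
      also have "\<dots> \<le> (\<Sum>i<k. \<Sum>j<k. (X $$ (i, j))\<^sup>2)"
        using 1 by (intro member_le_sum[of i "{..<k}" "\<lambda>i. \<Sum>j<k. (X $$ (i, j))\<^sup>2"] sum_nonneg) auto
      also have "\<dots> \<le> \<eta>" by (rule cor)
      finally have "\<bar>X $$ (i, j)\<bar> \<le> sqrt \<eta>" by (intro real_le_rsqrt) simp
      then show ?thesis using 1 \<eta>0 J by simp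
    next
      case 2
      then have "\<bar>X $$ (k + (i - k), j) - (if i - k = j then 1 else 0)\<bar> \<le> 4 * \<eta>"
        using ij by (intro L.near_one) auto
      moreover have "(if i - k = j then 1 else 0) = J_real k N $$ (i, j)" using 2 J by auto
      ultimately show ?thesis using s4 2 \<eta>0 by simp
    next
      case 3
      then have "\<bar>transpose_mat X $$ (k + (j - k), i) - (if j - k = i then 1 else 0)\<bar> \<le> 4 * \<eta>"
        using ij by (intro R.near_one) auto
      moreover have "(if j - k = i then 1 else 0) = J_real k N $$ (i, j)" using 3 J by auto
      moreover have "transpose_mat X $$ (k + (j - k), i) = X $$ (i, j)" using 3 ij Xc kN by simp
      ultimately show ?thesis using s4 \<eta>0 by simp
    next
      case 4
      \<comment> \<open>Row \<open>i\<close> has norm one, and its entry in column \<open>i - k\<close> nearly exhausts it.\<close>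
      define m where "m = i - k"
      have m: "m < k" "i = k + m" using 4 ij by (auto simp: m_def)
      have "(X $$ (i, m))\<^sup>2 + (X $$ (i, j))\<^sup>2 = (\<Sum>l\<in>{m, j}. (X $$ (i, l))\<^sup>2)"
        using 4 m by simp
      also have "\<dots> \<le> (\<Sum>l<k + N. (X $$ (i, l))\<^sup>2)"
        using ij 4 m kN by (intro sum_mono2) auto
      also have "\<dots> = 1"
        using orthogonal_group_rows[OF X, of i i] ij kN by (simp add: power2_eq_square)
      finally have s: "(X $$ (i, m))\<^sup>2 + (X $$ (i, j))\<^sup>2 \<le> 1" .
      have "1 - 4 * \<eta> \<le> X $$ (i, m)" using L.near_one[of m m] m by simp
      then have "(1 - 4 * \<eta>)\<^sup>2 \<le> (X $$ (i, m))\<^sup>2" using \<eta>16 by (intro power_mono) auto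
      then have "(X $$ (i, j))\<^sup>2 \<le> 9 * \<eta>" using s \<eta>0 
        by (simp add: power2_diff) (smt (verit) zero_le_power2)
      then have "\<bar>X $$ (i, j)\<bar> \<le> sqrt (9 * \<eta>)" by (intro real_le_rsqrt) simp
      then show ?thesis using 4 ij J by (simp add: real_sqrt_mult)
    qed
  qed
  show ?thesis
  proof (rule that[OF y(1) z], unfold F)
    fix i j assume ij: "i < k + N" "j < k + N"
    show "\<bar>(P \<oplus>\<^sub>d 1\<^sub>m (N - k)) $$ (i, j) - J_real k N $$ (i, j)\<bar>
        \<le> (if i < 2 * k \<and> j < 2 * k then 3 * sqrt \<eta> else 0)"
    proof (cases "i < 2 * k \<and> j < 2 * k")
      case True
      then have "(P \<oplus>\<^sub>d 1\<^sub>m (N - k)) $$ (i, j) = X $$ (i, j)"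
        using ij n by (subst dsum_index) (auto simp: P_def)
      then show ?thesis using est True by simp
    next
      case False
      have ij': "i < 2 * k + (N - k)" "j < 2 * k + (N - k)" using ij n by simp_all
      have "(P \<oplus>\<^sub>d 1\<^sub>m (N - k)) $$ (i, j)
          = (if 2 * k \<le> i \<and> 2 * k \<le> j then 1\<^sub>m (N - k) $$ (i - 2 * k, j - 2 * k) else 0)"
        using ij' False by (subst dsum_index_outside[of _ "2 * k" "2 * k"]) auto
      also have "\<dots> = J_real k N $$ (i, j)"
        unfolding J_real_def using ij' False
        by (subst dsum_index_outside[of _ "2 * k" "2 * k"]) (auto simp: mult_2)
      finally have "(P \<oplus>\<^sub>d 1\<^sub>m (N - k)) $$ (i, j) = J_real k N $$ (i, j)" .
      then show ?thesis by (simp only: if_not_P[OF False] diff_self abs_zero order_refl)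
    qed
  qed
qed

section \<open>Unitary matrices and the operator norm\<close>

lemma dsum_add:
  assumes "A \<in> carrier_mat m n" "A' \<in> carrier_mat m n" "B \<in> carrier_mat m' n'" "B' \<in> carrier_mat m' n'"
  shows "(A \<oplus>\<^sub>d B) + (A' \<oplus>\<^sub>d B') = (A + A') \<oplus>\<^sub>d (B + (B' :: 'a :: monoid_add mat))"
proof (rule eq_matI)
  fix i j assume "i < dim_row ((A + A') \<oplus>\<^sub>d (B + B'))" "j < dim_col ((A + A') \<oplus>\<^sub>d (B + B'))"
  then show "((A \<oplus>\<^sub>d B) + (A' \<oplus>\<^sub>d B')) $$ (i, j) = ((A + A') \<oplus>\<^sub>d (B + B')) $$ (i, j)"
    using assms by (cases "i < m"; cases "j < n") (simp_all add: dsum_index)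
qed (use assms in auto)

lemma dsum_minus:
  assumes "A \<in> carrier_mat m n" "A' \<in> carrier_mat m n" "B \<in> carrier_mat m' n'" "B' \<in> carrier_mat m' n'"
  shows "(A \<oplus>\<^sub>d B) - (A' \<oplus>\<^sub>d B') = (A - A') \<oplus>\<^sub>d (B - (B' :: 'a :: group_add mat))"
proof (rule eq_matI)
  fix i j assume "i < dim_row ((A - A') \<oplus>\<^sub>d (B - B'))" "j < dim_col ((A - A') \<oplus>\<^sub>d (B - B'))"
  then show "((A \<oplus>\<^sub>d B) - (A' \<oplus>\<^sub>d B')) $$ (i, j) = ((A - A') \<oplus>\<^sub>d (B - B')) $$ (i, j)"
    using assms by (cases "i < m"; cases "j < n") (simp_all add: dsum_index)
qed (use assms in auto)

lemma dsum_map_of_real: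
  "map_mat complex_of_real (A \<oplus>\<^sub>d B) = map_mat complex_of_real A \<oplus>\<^sub>d map_mat complex_of_real B"
  by (rule eq_matI) (auto simp: dsum_index)

lemma map_of_real_mult:
  assumes "A \<in> carrier_mat m n" "B \<in> carrier_mat n p"
  shows "map_mat complex_of_real (A * B) = map_mat complex_of_real A * map_mat complex_of_real B"
  using assms by (intro eq_matI) (auto simp: scalar_prod_def)

lemma map_of_real_one: "map_mat complex_of_real (1\<^sub>m n) = 1\<^sub>m n"
  by (rule eq_matI) auto

lemma mat_adjoint_dim [simp]:
  "dim_row (mat_adjoint A) = dim_col A" "dim_col (mat_adjoint A) = dim_row A"
  by (simp_all add: mat_adjoint_def)

lemma mat_adjoint_index [simp]:
  "i < dim_col A \<Longrightarrow> j < dim_row A \<Longrightarrow> mat_adjoint A $$ (i, j) = cnj (A $$ (j, i))"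
  by (simp add: mat_adjoint_def mat_of_rows_index)

lemma mat_adjoint_carrier [simp]:
  "A \<in> carrier_mat m n \<Longrightarrow> mat_adjoint A \<in> carrier_mat n m"
  by (rule carrier_matI) simp_all

lemma mat_adjoint_mult:
  assumes "A \<in> carrier_mat m n" "B \<in> carrier_mat n p"
  shows "mat_adjoint (A * B) = mat_adjoint B * mat_adjoint (A :: complex mat)"
  using assms by (intro eq_matI) (auto simp: scalar_prod_def mult.commute)

lemma mat_adjoint_one: "mat_adjoint (1\<^sub>m n) = (1\<^sub>m n :: complex mat)"
  by (rule eq_matI) auto

lemma mat_adjoint_dsum: "mat_adjoint (A \<oplus>\<^sub>d B) = mat_adjoint A \<oplus>\<^sub>d mat_adjoint (B :: complex mat)"
  by (rule eq_matI) (auto simp: dsum_index)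

lemma mat_adjoint_four_block:
  assumes "A \<in> carrier_mat m n" "B \<in> carrier_mat m n'" "C \<in> carrier_mat m' n" "D \<in> carrier_mat m' n'"
  shows "mat_adjoint (four_block_mat A B C D) =
    four_block_mat (mat_adjoint A) (mat_adjoint C) (mat_adjoint B) (mat_adjoint (D :: complex mat))"
  using assms by (intro eq_matI) auto

lemma unitary_group_carrier: "U \<in> unitary_group n \<Longrightarrow> U \<in> carrier_mat n n"
  by (simp add: unitary_group_def)

lemma unitary_group_left:
  assumes "U \<in> unitary_group n" shows "mat_adjoint U * U = 1\<^sub>m n"
  using assms mat_mult_left_right_inverse[of U n "mat_adjoint U"]
  by (simp add: unitary_group_def)

lemma unitary_group_mult:
  assumes "U \<in> unitary_group n" "V \<in> unitary_group n"
  shows "U * V \<in> unitary_group n"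
proof -
  note c = assms[THEN unitary_group_carrier]
  have "U * V * mat_adjoint (U * V) = U * (V * mat_adjoint V) * mat_adjoint U"
    using c by (simp add: mat_adjoint_mult[of U n n V n] assoc_mult_mat[of _ n n _ n _ n] mult_carrier_mat[of _ n n _ n])
  also have "\<dots> = U * mat_adjoint U"
    using assms by (simp add: unitary_group_def right_mult_one_mat[of U n n])
  also have "\<dots> = 1\<^sub>m n" using assms by (simp add: unitary_group_def)
  finally show ?thesis using c by (simp add: unitary_group_def)
qed

lemma vec_l2_norm_square:
  "(complex_of_real (vec_l2_norm v))\<^sup>2 = (\<Sum>i<dim_vec v. vec_index v i * cnj (vec_index v i))"
  unfolding vec_l2_norm_def L2_set_def
  by (simp add: sum_nonneg complex_norm_square flip: of_real_power)

lemma vec_l2_norm_unitary: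
  assumes U: "U \<in> unitary_group n" and v: "v \<in> carrier_vec n"
  shows "vec_l2_norm (U *\<^sub>v v) = vec_l2_norm v"
proof -
  note Uc = unitary_group_carrier[OF U]
  have cols: "(\<Sum>i<n. U $$ (i, j) * cnj (U $$ (i, l))) = (if j = l then 1 else 0)"
    if "j < n" "l < n" for j l
  proof -
    have "(mat_adjoint U * U) $$ (l, j) = (if j = l then 1 else 0)"
      using that unfolding unitary_group_left[OF U] by simp
    then show ?thesis
      using that Uc by (simp add: scalar_prod_def lessThan_atLeast0 mult.commute)
  qed
  have e: "vec_index (U *\<^sub>v v) i = (\<Sum>j<n. U $$ (i, j) * vec_index v j)" if "i < n" for i
    using that Uc v by (simp add: scalar_prod_def lessThan_atLeast0)
  have "(complex_of_real (vec_l2_norm (U *\<^sub>v v)))\<^sup>2 =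
      (\<Sum>i<n. (\<Sum>j<n. U $$ (i, j) * vec_index v j) * (\<Sum>l<n. cnj (U $$ (i, l)) * cnj (vec_index v l)))"
    using Uc by (simp add: vec_l2_norm_square e del: index_mult_mat_vec)
  also have "\<dots> = (\<Sum>i<n. \<Sum>j<n. \<Sum>l<n.
      (U $$ (i, j) * cnj (U $$ (i, l))) * (vec_index v j * cnj (vec_index v l)))"
    by (simp add: sum_product mult_ac)
  also have "\<dots> = (\<Sum>j<n. \<Sum>l<n. \<Sum>i<n.
      (U $$ (i, j) * cnj (U $$ (i, l))) * (vec_index v j * cnj (vec_index v l)))"
    by (subst sum.swap, rule sum.cong[OF refl], subst sum.swap, rule refl)
  also have "\<dots> = (\<Sum>j<n. \<Sum>l<n. if j = l then vec_index v j * cnj (vec_index v l) else 0)"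
    by (intro sum.cong refl) (simp add: sum_distrib_right[symmetric] cols)
  also have "\<dots> = (complex_of_real (vec_l2_norm v))\<^sup>2"
    using v by (simp add: vec_l2_norm_square)
  finally have "(vec_l2_norm (U *\<^sub>v v))\<^sup>2 = (vec_l2_norm v)\<^sup>2" by (simp only: of_real_eq_iff of_real_power[symmetric])
  then show ?thesis by (simp add: vec_l2_norm_nonneg)
qed

lemma op_norm_unitary_mult:
  assumes U: "U \<in> unitary_group n" and A: "A \<in> carrier_mat n n"
  shows "op_norm (U * A) \<le> op_norm A"
proof (rule op_norm_leI)
  fix v assume "v \<in> carrier_vec (dim_col (U * A))" and n: "vec_l2_norm v \<le> 1"
  then have v: "v \<in> carrier_vec n" using A by simp
  have "vec_l2_norm (U * A *\<^sub>v v) = vec_l2_norm (A *\<^sub>v v)"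
    using vec_l2_norm_unitary[OF U, of "A *\<^sub>v v"] unitary_group_carrier[OF U] A v
    by (simp add: assoc_mult_mat_vec[of U n n A n v])
  then show "vec_l2_norm (U * A *\<^sub>v v) \<le> op_norm A"
    using vec_l2_norm_le_op_norm[of v A] A v n by simp
qed

lemma op_norm_mult_unitary:
  assumes U: "U \<in> unitary_group n" and A: "A \<in> carrier_mat n n"
  shows "op_norm (A * U) \<le> op_norm A"
proof (rule op_norm_leI)
  note Uc = unitary_group_carrier[OF U]
  fix v assume "v \<in> carrier_vec (dim_col (A * U))" and n: "vec_l2_norm v \<le> 1"
  then have v: "v \<in> carrier_vec n" using Uc by simp
  have "vec_l2_norm (A * U *\<^sub>v v) = vec_l2_norm (A *\<^sub>v (U *\<^sub>v v))"
    using Uc A v by (simp add: assoc_mult_mat_vec[of A n n U n v])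
  then show "vec_l2_norm (A * U *\<^sub>v v) \<le> op_norm A"
    using vec_l2_norm_le_op_norm[of "U *\<^sub>v v" A] vec_l2_norm_unitary[OF U v] A Uc v n by simp
qed

text \<open>
  A crude bound for the operator norm. It is enough here because the matrices to be compared differ in
  a number of entries that does not depend on \<open>N\<close>.
\<close>

definition entry_sum :: "complex mat \<Rightarrow> real" where
  "entry_sum A = (\<Sum>i<dim_row A. \<Sum>j<dim_col A. cmod (A $$ (i, j)))"

lemma op_norm_le_entry_sum: "op_norm A \<le> entry_sum A"
proof (rule op_norm_leI)
  fix v assume v: "v \<in> carrier_vec (dim_col A)" and n: "vec_l2_norm v \<le> 1"
  have e: "cmod (vec_index v j) \<le> 1" if "j < dim_col A" for j
    using member_le_L2_set[of "{..<dim_vec v}" j "\<lambda>i. cmod (vec_index v i)"] that v n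
    unfolding vec_l2_norm_def by auto
  have "vec_l2_norm (A *\<^sub>v v) \<le> (\<Sum>i<dim_row A. cmod (vec_index (A *\<^sub>v v) i))"
    unfolding vec_l2_norm_def dim_mult_mat_vec by (rule L2_set_le_sum) simp
  also have "\<dots> \<le> entry_sum A"
    unfolding entry_sum_def
  proof (rule sum_mono)
    fix i assume i: "i \<in> {..<dim_row A}"
    have "cmod (vec_index (A *\<^sub>v v) i) = cmod (\<Sum>j<dim_col A. A $$ (i, j) * vec_index v j)"
      using i v by (simp add: scalar_prod_def lessThan_atLeast0)
    also have "\<dots> \<le> (\<Sum>j<dim_col A. cmod (A $$ (i, j)))"
      by (rule sum_norm_le) (use e in \<open>auto simp: norm_mult mult_left_le\<close>)
    finally show "cmod (vec_index (A *\<^sub>v v) i) \<le> (\<Sum>j<dim_col A. cmod (A $$ (i, j)))" .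
  qed
  finally show "vec_l2_norm (A *\<^sub>v v) \<le> entry_sum A" .
qed

lemma entry_sum_dsum: "entry_sum (A \<oplus>\<^sub>d B) = entry_sum A + entry_sum B"
  unfolding entry_sum_def by (simp add: sum_lessThan_add dsum_index)

section \<open>The subgroups of the large unitary group\<close>

definition K_mat :: "nat \<Rightarrow> real mat \<Rightarrow> complex mat" where
  "K_mat \<alpha> x = 1\<^sub>m \<alpha> \<oplus>\<^sub>d (map_mat complex_of_real x \<oplus>\<^sub>d map_mat complex_of_real x)"

lemma diag_block_mat_Cons: "diag_block_mat (A # As) = A \<oplus>\<^sub>d diag_block_mat As"
  by (simp add: dsum_def Let_def)

lemma dsum_empty: "A \<oplus>\<^sub>d diag_block_mat [] = A"
  by (rule eq_matI) (auto simp: dsum_index)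

lemma K_grp_eq: "K_grp \<alpha> k N = K_mat \<alpha> ` orthogonal_group (k + N)"
  unfolding K_grp_def K_mat_def by (simp add: diag_block_mat_Cons dsum_empty del: diag_block_mat.simps)

lemma J_mat_eq: "J_mat \<alpha> k N = K_mat \<alpha> (J_real k N)"
proof -
  have "map_mat complex_of_real (four_block_mat (0\<^sub>m k k) (1\<^sub>m k) (1\<^sub>m k) (0\<^sub>m k k)) = swap_mat k"
    unfolding swap_mat_def by (rule eq_matI) auto
  then show ?thesis
    unfolding J_mat_def K_mat_def J_real_def dsum_map_of_real map_of_real_one
    by (simp add: diag_block_mat_Cons dsum_empty dsum_assoc del: diag_block_mat.simps)
qed

lemma K_mat_carrier [simp]:
  "x \<in> carrier_mat n n \<Longrightarrow> K_mat \<alpha> x \<in> carrier_mat (\<alpha> + 2 * n) (\<alpha> + 2 * n)"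
  unfolding K_mat_def by (rule carrier_matI) simp_all

lemma K_mat_mult:
  assumes "x \<in> carrier_mat n n" "y \<in> carrier_mat n n"
  shows "K_mat \<alpha> x * K_mat \<alpha> y = K_mat \<alpha> (x * y)"
  unfolding K_mat_def using assms
  by (simp add: dsum_mult[of _ \<alpha> \<alpha> _ "n + n" "n + n" _ \<alpha> _ "n + n"]
      dsum_mult[of _ n n _ n n _ n _ n] map_of_real_mult[of _ n n _ n])

lemma K_mat_one: "K_mat \<alpha> (1\<^sub>m n) = 1\<^sub>m (\<alpha> + 2 * n)"
  unfolding K_mat_def by (simp add: map_of_real_one dsum_one mult_2)

lemma mat_adjoint_K_mat: "mat_adjoint (K_mat \<alpha> x) = K_mat \<alpha> (transpose_mat x)"
proof -
  have "mat_adjoint (map_mat complex_of_real x) = map_mat complex_of_real (transpose_mat x)"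
    by (rule eq_matI) auto
  then show ?thesis unfolding K_mat_def by (simp add: mat_adjoint_dsum mat_adjoint_one)
qed

lemma K_mat_unitary:
  assumes "x \<in> orthogonal_group n" shows "K_mat \<alpha> x \<in> unitary_group (\<alpha> + 2 * n)"
  using assms 
  by (simp add: unitary_group_def orthogonal_group_def mat_adjoint_K_mat K_mat_mult[of _ n] K_mat_one)

lemma K_mat_index:
  assumes "x \<in> carrier_mat n n" "i < n" "j < n"
  shows "K_mat \<alpha> x $$ (\<alpha> + i, \<alpha> + j) = complex_of_real (x $$ (i, j))"
  using assms unfolding K_mat_def by (subst dsum_index) (auto simp: dsum_index)

lemma entry_sum_K_mat_diff:
  assumes "x \<in> carrier_mat n n" "y \<in> carrier_mat n n"
  shows "entry_sum (K_mat \<alpha> x - K_mat \<alpha> y) = 2 * (\<Sum>i<n. \<Sum>j<n. \<bar>x $$ (i, j) - y $$ (i, j)\<bar>)"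
proof -
  have "entry_sum (map_mat complex_of_real x - map_mat complex_of_real y)
      = (\<Sum>i<n. \<Sum>j<n. \<bar>x $$ (i, j) - y $$ (i, j)\<bar>)"
    unfolding entry_sum_def using assms
    by (auto simp: of_real_diff[symmetric] simp del: of_real_diff intro!: sum.cong)
  moreover have "entry_sum (1\<^sub>m \<alpha> - 1\<^sub>m \<alpha>) = 0" by (simp add: entry_sum_def)
  ultimately show ?thesis
    unfolding K_mat_def using assms
    by (simp add: dsum_minus[of _ \<alpha> \<alpha> _ _ "n + n" "n + n"] dsum_minus[of _ n n _ _ n n] entry_sum_dsum)
qed

lemma embed_G_four_block:
  assumes "A \<in> carrier_mat (\<alpha> + k) (\<alpha> + k)" "B \<in> carrier_mat (\<alpha> + k) k"
    "C \<in> carrier_mat k (\<alpha> + k)" "D \<in> carrier_mat k k"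
  shows "embed_G \<alpha> k N (four_block_mat A B C D) =
    four_block_mat (A \<oplus>\<^sub>d 1\<^sub>m N) (B \<oplus>\<^sub>d 0\<^sub>m N N) (C \<oplus>\<^sub>d 0\<^sub>m N N) (D \<oplus>\<^sub>d 1\<^sub>m N)"
proof -
  have "split_block (four_block_mat A B C D) (\<alpha> + k) (\<alpha> + k) = (A, B, C, D)"
    unfolding split_block_def Let_def using assms by (auto intro!: eq_matI)
  then show ?thesis unfolding embed_G_def dsum_def using assms by simp
qed

lemma four_blocksE:
  assumes "g \<in> carrier_mat (\<alpha> + 2 * k) (\<alpha> + 2 * k)"
  obtains A B C D where "A \<in> carrier_mat (\<alpha> + k) (\<alpha> + k)" "B \<in> carrier_mat (\<alpha> + k) k"
    "C \<in> carrier_mat k (\<alpha> + k)" "D \<in> carrier_mat k k" "g = four_block_mat A B C D"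
proof -
  obtain A B C D where sp: "split_block g (\<alpha> + k) (\<alpha> + k) = (A, B, C, D)" by (metis prod_cases4)
  show ?thesis
    by (rule that[of A B C D]) (use split_block[OF sp, of k k] assms in \<open>auto simp: mult_2\<close>)
qed

lemma embed_G_carrier [simp]:
  assumes "g \<in> carrier_mat (\<alpha> + 2 * k) (\<alpha> + 2 * k)"
  shows "embed_G \<alpha> k N g \<in> carrier_mat (\<alpha> + 2 * (k + N)) (\<alpha> + 2 * (k + N))"
  using assms by (rule four_blocksE) (auto simp: embed_G_four_block intro!: carrier_matI)

lemma embed_G_mult:
  assumes "g \<in> carrier_mat (\<alpha> + 2 * k) (\<alpha> + 2 * k)" "h \<in> carrier_mat (\<alpha> + 2 * k) (\<alpha> + 2 * k)"
  shows "embed_G \<alpha> k N g * embed_G \<alpha> k N h = embed_G \<alpha> k N (g * h)"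
proof -
  obtain A B C D where g: "A \<in> carrier_mat (\<alpha> + k) (\<alpha> + k)" "B \<in> carrier_mat (\<alpha> + k) k"
    "C \<in> carrier_mat k (\<alpha> + k)" "D \<in> carrier_mat k k" "g = four_block_mat A B C D"
    using assms(1) by (rule four_blocksE)
  obtain A' B' C' D' where h: "A' \<in> carrier_mat (\<alpha> + k) (\<alpha> + k)" "B' \<in> carrier_mat (\<alpha> + k) k"
    "C' \<in> carrier_mat k (\<alpha> + k)" "D' \<in> carrier_mat k k" "h = four_block_mat A' B' C' D'"
    using assms(2) by (rule four_blocksE)
  let ?m = "\<alpha> + k"
  show ?thesis
    unfolding g(5) h(5) using g(1-4) h(1-4)
    by (simp add: embed_G_four_block mult_four_block_mat[of _ ?m ?m _ k _ k _ _ ?m _ k]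
        mult_four_block_mat[of _ "?m + N" "?m + N" _ "k + N" _ "k + N" _ _ "?m + N" _ "k + N"]
        dsum_mult[of _ ?m ?m _ N N _ ?m _ N] dsum_mult[of _ ?m k _ N N _ ?m _ N]
        dsum_mult[of _ k k _ N N _ ?m _ N] dsum_mult[of _ k ?m _ N N _ ?m _ N]
        dsum_mult[of _ ?m ?m _ N N _ k _ N] dsum_mult[of _ ?m k _ N N _ k _ N]
        dsum_mult[of _ k k _ N N _ k _ N] dsum_mult[of _ k ?m _ N N _ k _ N]
        dsum_add[of _ ?m ?m _ _ N N] dsum_add[of _ ?m k _ _ N N]
        dsum_add[of _ k ?m _ _ N N] dsum_add[of _ k k _ _ N N])
qed

lemma embed_G_one: "embed_G \<alpha> k N (1\<^sub>m (\<alpha> + 2 * k)) = 1\<^sub>m (\<alpha> + 2 * (k + N))"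
proof -
  have "0\<^sub>m m n \<oplus>\<^sub>d 0\<^sub>m p q = (0\<^sub>m (m + p) (n + q) :: complex mat)" for m n p q
    by (simp add: dsum_def)
  moreover have "1\<^sub>m (\<alpha> + 2 * k) =
      (four_block_mat (1\<^sub>m (\<alpha> + k)) (0\<^sub>m (\<alpha> + k) k) (0\<^sub>m k (\<alpha> + k)) (1\<^sub>m k) :: complex mat)"
    by (simp add: mult_2 add.assoc)
  ultimately show ?thesis
    by (simp add: embed_G_four_block dsum_one del: four_block_one_mat)
       (simp add: mult_2 add_ac)
qed

lemma mat_adjoint_embed_G:
  assumes "g \<in> carrier_mat (\<alpha> + 2 * k) (\<alpha> + 2 * k)"
  shows "mat_adjoint (embed_G \<alpha> k N g) = embed_G \<alpha> k N (mat_adjoint g)"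
proof -
  obtain A B C D where g: "A \<in> carrier_mat (\<alpha> + k) (\<alpha> + k)" "B \<in> carrier_mat (\<alpha> + k) k"
    "C \<in> carrier_mat k (\<alpha> + k)" "D \<in> carrier_mat k k" "g = four_block_mat A B C D"
    using assms(1) by (rule four_blocksE)
  have z: "mat_adjoint (0\<^sub>m N N) = (0\<^sub>m N N :: complex mat)" by (rule eq_matI) auto
  let ?m = "\<alpha> + k"
  show ?thesis
    unfolding g(5) using g(1-4)
    by (simp add: embed_G_four_block mat_adjoint_four_block[of _ ?m ?m _ k _ k]
        mat_adjoint_four_block[of _ "?m + N" "?m + N" _ "k + N" _ "k + N"]
        mat_adjoint_dsum mat_adjoint_one z)
qed

lemma embed_G_unitary:
  assumes "g \<in> unitary_group (\<alpha> + 2 * k)" shows "embed_G \<alpha> k N g \<in> G_grp \<alpha> k N"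
  using assms embed_G_carrier[of g \<alpha> k N] unfolding G_grp_def
  by (simp add: unitary_group_def mat_adjoint_embed_G embed_G_mult embed_G_one)

text \<open>
  The key algebraic fact: \<open>O(N)\<close> acts on the coordinates that \<open>U(\<alpha> + 2k)\<close> fixes. So in \<open>g x h\<close> the
  matrix \<open>x\<close> may be multiplied on both sides by \<open>O(N)\<close> without leaving the double coset.
\<close>

lemma embed_G_commute:
  assumes g: "g \<in> carrier_mat (\<alpha> + 2 * k) (\<alpha> + 2 * k)" and y: "y \<in> carrier_mat N N"
  shows "K_mat \<alpha> (1\<^sub>m k \<oplus>\<^sub>d y) * embed_G \<alpha> k N g = embed_G \<alpha> k N g * K_mat \<alpha> (1\<^sub>m k \<oplus>\<^sub>d y)"
proof -
  obtain A B C D where g: "A \<in> carrier_mat (\<alpha> + k) (\<alpha> + k)" "B \<in> carrier_mat (\<alpha> + k) k"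
    "C \<in> carrier_mat k (\<alpha> + k)" "D \<in> carrier_mat k k" "g = four_block_mat A B C D"
    using g by (rule four_blocksE)
  let ?m = "\<alpha> + k" and ?y = "map_mat complex_of_real y"
  have "K_mat \<alpha> (1\<^sub>m k \<oplus>\<^sub>d y) = (1\<^sub>m ?m \<oplus>\<^sub>d ?y) \<oplus>\<^sub>d (1\<^sub>m k \<oplus>\<^sub>d ?y)"
    unfolding K_mat_def dsum_map_of_real map_of_real_one by (simp add: dsum_assoc dsum_one)
  also have "\<dots> = four_block_mat (1\<^sub>m ?m \<oplus>\<^sub>d ?y) (0\<^sub>m (?m + N) (k + N)) (0\<^sub>m (k + N) (?m + N)) (1\<^sub>m k \<oplus>\<^sub>d ?y)"
    unfolding dsum_def[of "1\<^sub>m ?m \<oplus>\<^sub>d ?y"] using y by simp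
  finally have K: "K_mat \<alpha> (1\<^sub>m k \<oplus>\<^sub>d y) = \<dots>" .
  have yc: "?y \<in> carrier_mat N N" using y by simp
  have "K_mat \<alpha> (1\<^sub>m k \<oplus>\<^sub>d y) * embed_G \<alpha> k N g =
    four_block_mat (A \<oplus>\<^sub>d ?y) (B \<oplus>\<^sub>d 0\<^sub>m N N) (C \<oplus>\<^sub>d 0\<^sub>m N N) (D \<oplus>\<^sub>d ?y)"
    unfolding g(5) K using g(1-4) yc
    by (simp add: embed_G_four_block left_mult_zero_mat[of _ "?m + N" "k + N"]
        mult_four_block_mat[of _ "?m + N" "?m + N" _ "k + N" _ "k + N" _ _ "?m + N" _ "k + N"]
        dsum_mult[of _ ?m ?m _ N N _ ?m _ N] dsum_mult[of _ k k _ N N _ ?m _ N]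
        dsum_mult[of _ ?m ?m _ N N _ k _ N] dsum_mult[of _ k k _ N N _ k _ N]
        left_add_zero_mat[of _ "?m + N" "?m + N"] left_add_zero_mat[of _ "k + N" "?m + N"]
        right_add_zero_mat[of _ "?m + N" "k + N"] right_add_zero_mat[of _ "k + N" "?m + N"])
  also have "\<dots> = embed_G \<alpha> k N g * K_mat \<alpha> (1\<^sub>m k \<oplus>\<^sub>d y)"
    unfolding g(5) K using g(1-4) yc
    by (simp add: embed_G_four_block 
        mult_four_block_mat[of _ "?m + N" "?m + N" _ "k + N" _ "k + N" _ _ "?m + N" _ "k + N"]
        dsum_mult[of _ ?m ?m _ N N _ ?m _ N] dsum_mult[of _ k ?m _ N N _ ?m _ N]
        dsum_mult[of _ ?m k _ N N _ k _ N] dsum_mult[of _ k k _ N N _ k _ N])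
  finally show ?thesis .
qed

section \<open>Borel sets of matrices and convolutions\<close>

lemma openin_mtopology_Pow: "Metric_space S d \<Longrightarrow> {U. openin (Metric_space.mtopology S d) U} \<subseteq> Pow S"
  using Metric_space.openin_mtopology by blast

lemma space_mat_borel: 
  assumes "S \<subseteq> carrier_mat m n" shows "space (mat_borel S) = S"
  unfolding mat_borel_def using openin_mtopology_Pow[OF Metric_space_op_dist[OF assms]]
  by (rule space_measure_of)

lemma open_in_mat_borel:
  assumes "S \<subseteq> carrier_mat m n" "openin (Metric_space.mtopology S op_dist) U"
  shows "U \<in> sets (mat_borel S)"
  unfolding mat_borel_def using openin_mtopology_Pow[OF Metric_space_op_dist[OF assms(1)]] assms(2)
  by (simp add: sets_measure_of)

lemma nbhd_measurable:
  assumes S: "S \<subseteq> carrier_mat m n" and A: "A \<subseteq> S"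
  shows "nbhd S \<epsilon> A \<in> sets (mat_borel S)"
proof (rule open_in_mat_borel[OF S])
  interpret Metric_space S op_dist by (rule Metric_space_op_dist[OF S])
  have "nbhd S \<epsilon> A = (\<Union>a\<in>A. mball a \<epsilon>)"
    unfolding nbhd_def using A by (auto simp: commute) blast
  then show "openin mtopology (nbhd S \<epsilon> A)" by auto
qed

lemma entry_measurable:
  assumes S: "S \<subseteq> carrier_mat m n" and "i < m" "j < n"
  shows "(\<lambda>A. A $$ (i, j)) \<in> borel_measurable (mat_borel S)"
proof (rule borel_measurableI)
  fix V :: "complex set" assume V: "open V"
  interpret Metric_space S op_dist by (rule Metric_space_op_dist[OF S])
  show "(\<lambda>A. A $$ (i, j)) -` V \<inter> space (mat_borel S) \<in> sets (mat_borel S)"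
  proof (rule open_in_mat_borel[OF S], unfold space_mat_borel[OF S] openin_mtopology, intro conjI allI impI)
    fix A assume A: "A \<in> (\<lambda>A. A $$ (i, j)) -` V \<inter> S"
    then obtain e where e: "e > 0" "ball (A $$ (i, j)) e \<subseteq> V"
      using V unfolding open_contains_ball by auto
    have "B \<in> (\<lambda>A. A $$ (i, j)) -` V \<inter> S" if B: "B \<in> mball A e" for B
    proof -
      have c: "A \<in> carrier_mat m n" "B \<in> carrier_mat m n" using A B S by auto
      have "cmod ((A - B) $$ (i, j)) \<le> op_norm (A - B)"
        using c assms by (intro op_norm_entry) auto
      also have "\<dots> < e" using B c by (simp add: op_dist_def)
      finally have "B $$ (i, j) \<in> ball (A $$ (i, j)) e"
        using c assms by (simp add: dist_norm)
      then show ?thesis using e B by auto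
    qed
    then show "\<exists>r>0. mball A r \<subseteq> (\<lambda>A. A $$ (i, j)) -` V \<inter> S" using e(1) by blast
  qed simp
qed

text \<open>
  The Borel \<open>\<sigma>\<close>-algebra is generated by the matrix entries. The entries embed the matrices into the
  space of functions on pairs of indices, which is second countable, and every open set of matrices is
  the preimage of a union of open boxes there.
\<close>

lemma measurable_into_mat_borel:
  assumes S: "S \<subseteq> carrier_mat m n" and f: "\<And>x. x \<in> space M \<Longrightarrow> f x \<in> S"
    and entries: "\<And>i j. i < m \<Longrightarrow> j < n \<Longrightarrow> (\<lambda>x. f x $$ (i, j)) \<in> borel_measurable M"
  shows "f \<in> measurable M (mat_borel S)"
  unfolding mat_borel_def
proof (rule measurable_measure_of)
  interpret Metric_space S op_dist by (rule Metric_space_op_dist[OF S])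
  show "{U. openin mtopology U} \<subseteq> Pow S" by (rule openin_mtopology_Pow[OF Metric_space_op_dist[OF S]])
  show "f \<in> space M \<rightarrow> S" using f by auto
  fix U assume "U \<in> {U. openin mtopology U}"
  then have "openin mtopology U" by simp
  then have US: "U \<subseteq> S" and Uo: "\<forall>A\<in>U. \<exists>r>0. mball A r \<subseteq> U" unfolding openin_mtopology by blast+
  then obtain r where r: "\<And>A. A \<in> U \<Longrightarrow> r A > 0" "\<And>A. A \<in> U \<Longrightarrow> mball A (r A) \<subseteq> U" by metis
  define \<phi> :: "complex mat \<Rightarrow> nat \<times> nat \<Rightarrow> complex"
    where "\<phi> A = (\<lambda>(i, j). if i < m \<and> j < n then A $$ (i, j) else 0)" for A
  define box where "box A = (\<Inter>ij\<in>{..<m} \<times> {..<n}. (\<lambda>w. w ij) -` ball (A $$ ij) (r A / (real (m * n) + 1)))" for A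
  have open_box: "open (box A)" for A
    unfolding box_def by (intro open_INT finite_cartesian_product ballI open_vimage) (auto simp: continuous_on_product_coordinates)
  have mem: "B \<in> U" if A: "A \<in> U" and B: "B \<in> S" "\<phi> B \<in> box A" for A B
  proof -
    have c: "A \<in> carrier_mat m n" "B \<in> carrier_mat m n" using A B US S by auto
    have e: "cmod (A $$ (i, j) - B $$ (i, j)) \<le> r A / (real (m * n) + 1)" if "i < m" "j < n" for i j
    proof -
      have "\<phi> B (i, j) \<in> ball (A $$ (i, j)) (r A / (real (m * n) + 1))"
        using B(2) that unfolding box_def by blast
      then show ?thesis using that by (simp add: \<phi>_def dist_norm)
    qed
    have "op_norm (A - B) \<le> entry_sum (A - B)" by (rule op_norm_le_entry_sum)
    also have "\<dots> = (\<Sum>i<m. \<Sum>j<n. cmod (A $$ (i, j) - B $$ (i, j)))"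
      unfolding entry_sum_def using c by simp
    also have "\<dots> \<le> (\<Sum>i<m. \<Sum>j<n. r A / (real (m * n) + 1))"
      by (intro sum_mono e) auto
    also have "\<dots> = real (m * n) * r A / (real (m * n) + 1)" by simp
    also have "\<dots> < r A"
    proof -
      have "0 < real (m * n) + 1" by (rule add_nonneg_pos) simp_all
      then show ?thesis using r(1)[OF A] by (simp add: pos_divide_less_eq distrib_left del: of_nat_mult)
    qed
    finally have "B \<in> mball A (r A)" using A US B c by (auto simp: op_dist_def)
    then show ?thesis using r(2)[OF A] by blast
  qed
  have U: "f -` U \<inter> space M = (\<lambda>x. \<phi> (f x)) -` (\<Union>A\<in>U. box A) \<inter> space M"
  proof (intro equalityI subsetI)
    fix x assume x: "x \<in> f -` U \<inter> space M"
    have "0 < real m * real n + 1" by (rule add_nonneg_pos) simp_all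
    then have "\<phi> (f x) \<in> box (f x)" using r(1)[of "f x"] x unfolding box_def \<phi>_def by auto
    then show "x \<in> (\<lambda>x. \<phi> (f x)) -` (\<Union>A\<in>U. box A) \<inter> space M" using x by auto
  qed (use mem f in auto)
  have "(\<lambda>x. \<phi> (f x)) \<in> borel_measurable M"
  proof (rule measurable_coordinatewise_then_product)
    fix ij :: "nat \<times> nat"
    show "(\<lambda>x. \<phi> (f x) ij) \<in> borel_measurable M"
      unfolding \<phi>_def using entries by (cases ij; cases "fst ij < m"; cases "snd ij < n") simp_all
  qed
  then show "f -` U \<inter> space M \<in> sets M"
    unfolding U using open_box by (intro measurable_sets[of _ M borel]) (auto intro!: borel_open)
qed

abbreviation U_borel :: "nat \<Rightarrow> complex mat measure" where
  "U_borel n \<equiv> mat_borel (unitary_group n)"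

lemma unitary_group_subset: "unitary_group n \<subseteq> carrier_mat n n"
  by (auto simp: unitary_group_def)

lemmas space_U_borel = space_mat_borel[OF unitary_group_subset]

lemma mult_measurable:
  "(\<lambda>(x, y). x * y) \<in> measurable (U_borel n \<Otimes>\<^sub>M U_borel n) (U_borel n)"
proof (rule measurable_into_mat_borel[OF unitary_group_subset])
  fix i j assume ij: "i < n" "j < n"
  have "(\<lambda>p. \<Sum>l<n. fst p $$ (i, l) * snd p $$ (l, j)) \<in> borel_measurable (U_borel n \<Otimes>\<^sub>M U_borel n)"
    using ij by (intro borel_measurable_sum borel_measurable_times
      measurable_compose[OF measurable_fst entry_measurable[OF unitary_group_subset]]
      measurable_compose[OF measurable_snd entry_measurable[OF unitary_group_subset]]) auto
  also have "?this \<longleftrightarrow> (\<lambda>p. (case p of (x, y) \<Rightarrow> x * y) $$ (i, j)) \<in> borel_measurable (U_borel n \<Otimes>\<^sub>M U_borel n)"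
    using ij by (intro measurable_cong) 
      (auto simp: space_pair_measure space_U_borel scalar_prod_def lessThan_atLeast0 dest!: unitary_group_carrier)
  finally show "(\<lambda>p. (case p of (x, y) \<Rightarrow> x * y) $$ (i, j)) \<in> borel_measurable (U_borel n \<Otimes>\<^sub>M U_borel n)" .
qed (auto simp: space_pair_measure space_U_borel unitary_group_mult)

definition Borel_prob :: "nat \<Rightarrow> complex mat measure \<Rightarrow> bool" where
  "Borel_prob n \<mu> \<longleftrightarrow> prob_space \<mu> \<and> sets \<mu> = sets (U_borel n)"

lemma mult_right_measurable:
  assumes "y \<in> unitary_group n" "S \<in> sets (U_borel n)"
  shows "{x \<in> unitary_group n. x * y \<in> S} \<in> sets (U_borel n)"
proof -
  have "(\<lambda>x. (x, y)) \<in> measurable (U_borel n) (U_borel n \<Otimes>\<^sub>M U_borel n)"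
    using assms(1) by (intro measurable_Pair2') (simp add: space_U_borel)
  from measurable_sets[OF measurable_compose[OF this mult_measurable] assms(2)]
  show ?thesis by (simp add: space_U_borel vimage_def Int_def conj_commute)
qed

lemma Borel_prob_conv:
  assumes \<mu>: "Borel_prob n \<mu>" and \<nu>: "Borel_prob n \<nu>"
  shows "Borel_prob n (mat_conv (unitary_group n) \<mu> \<nu>)" (is ?prob)
    and "S \<in> sets (U_borel n) \<Longrightarrow>
      emeasure (mat_conv (unitary_group n) \<mu> \<nu>) S
        = (\<integral>\<^sup>+y. emeasure \<mu> {x \<in> unitary_group n. x * y \<in> S} \<partial>\<nu>)" (is "_ \<Longrightarrow> ?em")
    and "S \<in> sets (U_borel n) \<Longrightarrow>
      (\<lambda>y. emeasure \<mu> {x \<in> unitary_group n. x * y \<in> S}) \<in> borel_measurable (U_borel n)" (is "_ \<Longrightarrow> ?meas")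
proof -
  have sets: "sets \<mu> = sets (U_borel n)" "sets \<nu> = sets (U_borel n)"
    using \<mu> \<nu> by (simp_all add: Borel_prob_def)
  interpret M: prob_space \<mu> using \<mu> by (simp add: Borel_prob_def)
  interpret N: prob_space \<nu> using \<nu> by (simp add: Borel_prob_def)
  interpret pair_prob_space \<mu> \<nu> ..
  have sp: "space \<mu> = unitary_group n" "space \<nu> = unitary_group n"
    using sets_eq_imp_space_eq[OF sets(1)] sets_eq_imp_space_eq[OF sets(2)] by (simp_all add: space_U_borel)
  have m: "(\<lambda>(x, y). x * y) \<in> measurable (\<mu> \<Otimes>\<^sub>M \<nu>) (U_borel n)"
    using mult_measurable[of n] measurable_cong_sets[OF sets_pair_measure_cong[OF sets] refl] by blast
  show ?prob
    unfolding Borel_prob_def mat_conv_def using prob_space_distr[OF m] by simp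
  assume S: "S \<in> sets (U_borel n)"
  define Q where "Q = (\<lambda>(x, y). x * y) -` S \<inter> space (\<mu> \<Otimes>\<^sub>M \<nu>)"
  have Q: "Q \<in> sets (\<mu> \<Otimes>\<^sub>M \<nu>)" unfolding Q_def using m S by (rule measurable_sets)
  have sec: "(\<lambda>x. (x, y)) -` Q = {x \<in> unitary_group n. x * y \<in> S}" if "y \<in> unitary_group n" for y
    using that by (auto simp: Q_def space_pair_measure sp)
  have "emeasure (mat_conv (unitary_group n) \<mu> \<nu>) S = emeasure (\<mu> \<Otimes>\<^sub>M \<nu>) Q"
    unfolding mat_conv_def Q_def using m S by (rule emeasure_distr)
  also have "\<dots> = (\<integral>\<^sup>+y. emeasure \<mu> ((\<lambda>x. (x, y)) -` Q) \<partial>\<nu>)" by (rule emeasure_pair_measure_alt2[OF Q])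
  also have "\<dots> = (\<integral>\<^sup>+y. emeasure \<mu> {x \<in> unitary_group n. x * y \<in> S} \<partial>\<nu>)"
    by (rule nn_integral_cong) (simp add: sec sp)
  finally show ?em .
  have "(\<lambda>y. emeasure \<mu> ((\<lambda>x. (x, y)) -` Q)) \<in> borel_measurable \<nu>" by (rule measurable_emeasure_Pair2[OF Q])
  also have "?this \<longleftrightarrow> (\<lambda>y. emeasure \<mu> {x \<in> unitary_group n. x * y \<in> S}) \<in> borel_measurable \<nu>"
    by (rule measurable_cong) (simp add: sec sp)
  finally show ?meas using measurable_cong_sets[OF sets(2) refl] by blast
qed

lemma Borel_prob_return:
  assumes "a \<in> unitary_group n" shows "Borel_prob n (return (U_borel n) a)"
  unfolding Borel_prob_def using assms by (simp add: prob_space_return space_U_borel)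

lemma emeasure_conv_return:
  assumes \<mu>: "Borel_prob n \<mu>" and a: "a \<in> unitary_group n" and S: "S \<in> sets (U_borel n)"
  shows "emeasure (mat_conv (unitary_group n) \<mu> (return (U_borel n) a)) S
    = emeasure \<mu> {x \<in> unitary_group n. x * a \<in> S}"
  using Borel_prob_conv(2,3)[OF \<mu> Borel_prob_return[OF a] S] a
  by (simp add: nn_integral_return space_U_borel)

text \<open>
  The outer factors \<open>\<kappa>\<close> of \<open>\<kappa> * \<delta>\<^sub>g * \<kappa> * \<delta>\<^sub>h * \<kappa>\<close> are invisible to a set that is invariant under \<open>K\<close> on
  both sides; only the middle one is felt. Membership of \<open>u g x h\<close> does not depend on \<open>u\<close>, so its inner
  integral is an indicator function of \<open>x\<close>.
\<close>

lemma emeasure_conv_bi_invariant: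
  assumes K: "K \<subseteq> unitary_group n" and \<kappa>: "prob_space \<kappa>" "sets \<kappa> = sets (mat_borel K)"
    and S: "S \<in> sets (U_borel n)"
    and left: "\<And>u w. u \<in> K \<Longrightarrow> w \<in> unitary_group n \<Longrightarrow> u * w \<in> S \<longleftrightarrow> w \<in> S"
    and right: "\<And>u w. u \<in> K \<Longrightarrow> w \<in> unitary_group n \<Longrightarrow> w * u \<in> S \<longleftrightarrow> w \<in> S"
    and g: "g \<in> unitary_group n" and h: "h \<in> unitary_group n"
  defines "\<kappa>G \<equiv> distr \<kappa> (U_borel n) (\<lambda>x. x)" and "G \<equiv> unitary_group n"
  shows "emeasure (mat_conv G (mat_conv G (mat_conv G (mat_conv G \<kappa>G (return (U_borel n) g)) \<kappa>G)
      (return (U_borel n) h)) \<kappa>G) S = emeasure \<kappa> {x \<in> K. g * x * h \<in> S}"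
    and "{x \<in> K. g * x * h \<in> S} \<in> sets \<kappa>"
proof -
  interpret prob_space \<kappa> by fact
  have Kc: "K \<subseteq> carrier_mat n n" using K unitary_group_subset by blast
  have spK: "space \<kappa> = K" using sets_eq_imp_space_eq[OF \<kappa>(2)] by (simp add: space_mat_borel[OF Kc])
  have spS: "S \<subseteq> G" using sets.sets_into_space[OF S] by (simp add: space_U_borel G_def)
  have id: "(\<lambda>x. x) \<in> measurable \<kappa> (U_borel n)"
  proof (rule measurable_into_mat_borel[OF unitary_group_subset])
    show "(\<lambda>x. x $$ (i, j)) \<in> borel_measurable \<kappa>" if "i < n" "j < n" for i j
      using entry_measurable[OF Kc that] measurable_cong_sets[OF \<kappa>(2) refl] by blast
  qed (use K spK in auto)
  have \<kappa>G: "Borel_prob n \<kappa>G" unfolding Borel_prob_def \<kappa>G_def using prob_space_distr[OF id] by simp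
  have em: "emeasure \<kappa>G T = emeasure \<kappa> {x \<in> K. x \<in> T}" if "T \<in> sets (U_borel n)" for T
    unfolding \<kappa>G_def using emeasure_distr[OF id that] by (simp add: spK Int_def conj_commute)
  have int: "(\<integral>\<^sup>+x. F x \<partial>\<kappa>G) = (\<integral>\<^sup>+x. F x \<partial>\<kappa>)" if "F \<in> borel_measurable (U_borel n)" for F
    unfolding \<kappa>G_def using that by (subst nn_integral_distr[OF id]) auto
  define \<mu>1 where "\<mu>1 = mat_conv G \<kappa>G (return (U_borel n) g)"
  define \<mu>2 where "\<mu>2 = mat_conv G \<mu>1 \<kappa>G"
  define \<mu>3 where "\<mu>3 = mat_conv G \<mu>2 (return (U_borel n) h)"
  have p1: "Borel_prob n \<mu>1" unfolding \<mu>1_def G_def by (rule Borel_prob_conv(1)[OF \<kappa>G Borel_prob_return[OF g]])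
  have p2: "Borel_prob n \<mu>2" unfolding \<mu>2_def G_def by (rule Borel_prob_conv(1)[OF p1 \<kappa>G])
  have p3: "Borel_prob n \<mu>3" unfolding \<mu>3_def G_def by (rule Borel_prob_conv(1)[OF p2 Borel_prob_return[OF h]])
  define T where "T = {w \<in> G. w * h \<in> S}"
  have T: "T \<in> sets (U_borel n)" unfolding T_def G_def by (rule mult_right_measurable[OF h S])
  have setE: "{x \<in> K. g * x * h \<in> S} = {x \<in> K. g * x \<in> T}"
    using K g by (auto simp: T_def G_def intro: unitary_group_mult)
  have gx: "(\<lambda>x. g * x) \<in> measurable (U_borel n) (U_borel n)"
    using measurable_compose[OF measurable_Pair1'[of g "U_borel n" "U_borel n"] mult_measurable] g
    by (simp add: space_U_borel)
  show meas: "{x \<in> K. g * x * h \<in> S} \<in> sets \<kappa>"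
  proof -
    have "(\<lambda>x. g * x) -` T \<inter> space \<kappa> \<in> sets \<kappa>"
      using measurable_sets[OF measurable_compose[OF id gx] T] .
    then show ?thesis unfolding setE by (simp add: spK vimage_def Int_def conj_commute)
  qed
  have "emeasure (mat_conv G \<mu>3 \<kappa>G) S = (\<integral>\<^sup>+v. emeasure \<mu>3 {w \<in> G. w * v \<in> S} \<partial>\<kappa>)"
    unfolding G_def using Borel_prob_conv(2,3)[OF p3 \<kappa>G S] by (simp add: int)
  also have "\<dots> = (\<integral>\<^sup>+v. emeasure \<mu>3 S \<partial>\<kappa>)"
  proof (rule nn_integral_cong)
    fix v assume "v \<in> space \<kappa>"
    then have "{w \<in> G. w * v \<in> S} = S" using right[of v] spS by (auto simp: spK G_def)
    then show "emeasure \<mu>3 {w \<in> G. w * v \<in> S} = emeasure \<mu>3 S" by simp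
  qed
  also have "\<dots> = emeasure \<mu>3 S" by (simp add: emeasure_space_1)
  also have "\<dots> = emeasure \<mu>2 T"
    unfolding \<mu>3_def G_def T_def by (rule emeasure_conv_return[OF p2 h S])
  also have "\<dots> = (\<integral>\<^sup>+x. emeasure \<mu>1 {w \<in> G. w * x \<in> T} \<partial>\<kappa>)"
    unfolding \<mu>2_def G_def using Borel_prob_conv(2,3)[OF p1 \<kappa>G T] by (simp add: int)
  also have "\<dots> = (\<integral>\<^sup>+x. indicator {x \<in> K. g * x * h \<in> S} x \<partial>\<kappa>)"
  proof (rule nn_integral_cong)
    fix x assume "x \<in> space \<kappa>"
    then have xK: "x \<in> K" by (simp add: spK)
    then have x: "x \<in> unitary_group n" using K by auto
    define R where "R = {w \<in> G. w * x \<in> T}"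
    have R: "R \<in> sets (U_borel n)" unfolding R_def G_def by (rule mult_right_measurable[OF x T])
    have "emeasure \<mu>1 R = emeasure \<kappa>G {u \<in> G. u * g \<in> R}"
      unfolding \<mu>1_def G_def by (rule emeasure_conv_return[OF \<kappa>G g R])
    also have "\<dots> = emeasure \<kappa> {u \<in> K. u \<in> {u \<in> G. u * g \<in> R}}"
      unfolding G_def by (intro em mult_right_measurable g R)
    also have "{u \<in> K. u \<in> {u \<in> G. u * g \<in> R}} = {u \<in> K. g * x * h \<in> S}"
    proof -
      have "u * g \<in> R \<longleftrightarrow> g * x * h \<in> S" if u: "u \<in> K" for u
      proof -
        have uG: "u \<in> unitary_group n" using u K by auto
        note c = unitary_group_carrier[OF uG] unitary_group_carrier[OF g] unitary_group_carrier[OF x] unitary_group_carrier[OF h]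
        have "u * g * x * h = u * (g * x * h)"
          using c by (simp add: assoc_mult_mat[of _ n n _ n _ n] mult_carrier_mat[of _ n n _ n])
        then show ?thesis
          using left[OF u, of "g * x * h"] uG g x h
          by (auto simp: R_def T_def G_def unitary_group_mult)
      qed
      then show ?thesis using K by (auto simp: G_def)
    qed
    also have "emeasure \<kappa> {u \<in> K. g * x * h \<in> S} = indicator {x \<in> K. g * x * h \<in> S} x"
      using emeasure_space_1 xK by (cases "g * x * h \<in> S") (simp_all add: spK)
    finally show "emeasure \<mu>1 {w \<in> G. w * x \<in> T} = indicator {x \<in> K. g * x * h \<in> S} x" by (simp add: R_def)
  qed
  also have "\<dots> = emeasure \<kappa> {x \<in> K. g * x * h \<in> S}" using meas by simp
  finally show "emeasure (mat_conv G (mat_conv G (mat_conv G (mat_conv G \<kappa>G (return (U_borel n) g)) \<kappa>G)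
      (return (U_borel n) h)) \<kappa>G) S = emeasure \<kappa> {x \<in> K. g * x * h \<in> S}"
    unfolding \<mu>3_def \<mu>2_def \<mu>1_def .
qed

section \<open>The distribution of the corner of a Haar random matrix\<close>

lemma K_grp_unitary: "K_grp \<alpha> k N \<subseteq> G_grp \<alpha> k N"
  unfolding K_grp_eq G_grp_def using K_mat_unitary by blast

lemma K_grp_carrier: "K_grp \<alpha> k N \<subseteq> carrier_mat (\<alpha> + 2 * (k + N)) (\<alpha> + 2 * (k + N))"
  using K_grp_unitary unitary_group_subset unfolding G_grp_def by blast

lemma K_grp_mult: "u \<in> K_grp \<alpha> k N \<Longrightarrow> v \<in> K_grp \<alpha> k N \<Longrightarrow> u * v \<in> K_grp \<alpha> k N"
  unfolding K_grp_eq
  by (auto simp: K_mat_mult[OF orthogonal_group_carrier orthogonal_group_carrier] intro: orthogonal_group_mult)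

lemma K_grp_inverse:
  assumes "u \<in> K_grp \<alpha> k N" shows "mat_adjoint u \<in> K_grp \<alpha> k N"
  using assms unfolding K_grp_eq by (auto simp: mat_adjoint_K_mat intro: orthogonal_group_transpose)

lemma unitary_cancel_left:
  assumes "u \<in> unitary_group n" "w \<in> carrier_mat n p"
  shows "mat_adjoint u * (u * w) = w" and "u * (mat_adjoint u * w) = w"
proof -
  note c = unitary_group_carrier[OF assms(1)]
  show "mat_adjoint u * (u * w) = w"
    using assoc_mult_mat[of "mat_adjoint u" n n u n w p] c assms by (simp add: unitary_group_left)
  show "u * (mat_adjoint u * w) = w"
    using assoc_mult_mat[of u n n "mat_adjoint u" n w p] c assms by (simp add: unitary_group_def)
qed

lemma unitary_cancel_right:
  assumes "u \<in> unitary_group n" "w \<in> carrier_mat p n"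
  shows "w * u * mat_adjoint u = w"
  using assoc_mult_mat[of w p n u n "mat_adjoint u" n] unitary_group_carrier[OF assms(1)] assms
  by (simp add: unitary_group_def right_mult_one_mat[of w p n])

lemma haar_nn_integral:
  assumes haar: "haar_prob (K_grp \<alpha> k N) \<kappa>" and u: "u \<in> K_grp \<alpha> k N"
    and F: "F \<in> borel_measurable \<kappa>"
  shows "(\<integral>\<^sup>+x. F (u * x) \<partial>\<kappa>) = (\<integral>\<^sup>+x. F x \<partial>\<kappa>)"
proof -
  let ?K = "K_grp \<alpha> k N" and ?n = "\<alpha> + 2 * (k + N)"
  have sets: "sets \<kappa> = sets (mat_borel ?K)"
    and inv: "\<And>g E. g \<in> ?K \<Longrightarrow> E \<in> sets \<kappa> \<Longrightarrow> emeasure \<kappa> ((\<lambda>x. g * x) ` E) = emeasure \<kappa> E"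
    using haar by (auto simp: haar_prob_def)
  have sp: "space \<kappa> = ?K" using sets_eq_imp_space_eq[OF sets] by (simp add: space_mat_borel[OF K_grp_carrier])
  have uG: "u \<in> unitary_group ?n" using u K_grp_unitary[of \<alpha> k N] by (auto simp: G_grp_def)
  have Kc: "x \<in> carrier_mat ?n ?n" if "x \<in> ?K" for x using that K_grp_carrier by blast
  have m: "(\<lambda>x. u * x) \<in> measurable \<kappa> (mat_borel ?K)"
  proof (rule measurable_into_mat_borel[OF K_grp_carrier])
    fix i j assume ij: "i < ?n" "j < ?n"
    have "(\<lambda>x. \<Sum>l<?n. u $$ (i, l) * x $$ (l, j)) \<in> borel_measurable (mat_borel ?K)"
      using ij by (intro borel_measurable_sum borel_measurable_times borel_measurable_const entry_measurable[OF K_grp_carrier]) auto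
    also have "?this \<longleftrightarrow> (\<lambda>x. (u * x) $$ (i, j)) \<in> borel_measurable (mat_borel ?K)"
      using ij Kc[OF u] by (intro measurable_cong)
        (auto simp: space_mat_borel[OF K_grp_carrier] scalar_prod_def lessThan_atLeast0 dest!: Kc)
    finally show "(\<lambda>x. (u * x) $$ (i, j)) \<in> borel_measurable \<kappa>"
      using measurable_cong_sets[OF sets refl] by blast
  qed (simp add: sp K_grp_mult u)
  then have m': "(\<lambda>x. u * x) \<in> measurable \<kappa> \<kappa>" using measurable_cong_sets[OF refl sets] by blast
  have "distr \<kappa> \<kappa> (\<lambda>x. u * x) = \<kappa>"
  proof (rule measure_eqI)
    fix E assume "E \<in> sets (distr \<kappa> \<kappa> (\<lambda>x. u * x))"
    then have E: "E \<in> sets \<kappa>" by simp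
    then have EK: "E \<subseteq> ?K" using sets.sets_into_space sp by blast
    have "(\<lambda>x. u * x) -` E \<inter> space \<kappa> = (\<lambda>x. mat_adjoint u * x) ` E"
    proof (intro equalityI subsetI)
      fix x assume "x \<in> (\<lambda>x. u * x) -` E \<inter> space \<kappa>"
      then have "x \<in> ?K" "u * x \<in> E" using sp by auto
      then show "x \<in> (\<lambda>x. mat_adjoint u * x) ` E"
        using unitary_cancel_left(1)[OF uG Kc, of x] by (intro image_eqI[of _ _ "u * x"]) auto
    next
      fix x assume "x \<in> (\<lambda>x. mat_adjoint u * x) ` E"
      then obtain e where e: "e \<in> E" "x = mat_adjoint u * e" by blast
      then have "e \<in> ?K" using EK by blast
      then show "x \<in> (\<lambda>x. u * x) -` E \<inter> space \<kappa>"
        using e unitary_cancel_left(2)[OF uG Kc] K_grp_mult[OF K_grp_inverse[OF u]] by (simp add: sp)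
    qed
    then show "emeasure (distr \<kappa> \<kappa> (\<lambda>x. u * x)) E = emeasure \<kappa> E"
      using emeasure_distr[OF m' E] inv[OF K_grp_inverse[OF u] E] by simp
  qed simp
  then show ?thesis using nn_integral_distr[OF m', of F] F by simp
qed

text \<open>
  Exchanging two rows is left multiplication by an element of the group, so the squares of the entries of
  a column have equal means; their sum is one, and there are \<open>k + N\<close> of them.
\<close>

lemma haar_entry_moment:
  assumes haar: "haar_prob (K_grp \<alpha> k N) \<kappa>" and ij: "i < k + N" "j < k + N"
  shows "(\<integral>\<^sup>+x. ennreal ((cmod (x $$ (\<alpha> + i, \<alpha> + j)))\<^sup>2) \<partial>\<kappa>) = ennreal (1 / real (k + N))"
proof -
  let ?K = "K_grp \<alpha> k N" and ?n = "k + N"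
  have sets: "sets \<kappa> = sets (mat_borel ?K)" and prob: "prob_space \<kappa>"
    using haar by (auto simp: haar_prob_def)
  interpret prob_space \<kappa> by (rule prob)
  have sp: "space \<kappa> = ?K" using sets_eq_imp_space_eq[OF sets] by (simp add: space_mat_borel[OF K_grp_carrier])
  define e where "e i = (\<lambda>x :: complex mat. ennreal ((cmod (x $$ (\<alpha> + i, \<alpha> + j)))\<^sup>2))" for i
  have m: "e i \<in> borel_measurable \<kappa>" if "i < ?n" for i
  proof -
    have "(\<lambda>x. x $$ (\<alpha> + i, \<alpha> + j)) \<in> borel_measurable \<kappa>"
      using entry_measurable[OF K_grp_carrier, of "\<alpha> + i" \<alpha> k N "\<alpha> + j"] that ij measurable_cong_sets[OF sets refl]
      by auto
    then show ?thesis unfolding e_def by measurable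
  qed
  have eq: "(\<integral>\<^sup>+x. e l x \<partial>\<kappa>) = (\<integral>\<^sup>+x. e i x \<partial>\<kappa>)" if l: "l < ?n" for l
  proof -
    define s :: "real mat" where "s = swaprows_mat ?n i l"
    have "transpose_mat s = s" unfolding s_def using ij l by (intro eq_matI) auto
    then have s: "s \<in> orthogonal_group ?n"
      using swaprows_mat_inv[OF ij(1) l] by (simp add: orthogonal_group_def s_def)
    have "e i (K_mat \<alpha> s * x) = e l x" if "x \<in> space \<kappa>" for x
    proof -
      obtain y where y: "y \<in> orthogonal_group ?n" "x = K_mat \<alpha> y" using \<open>x \<in> space \<kappa>\<close> unfolding sp K_grp_eq by blast
      note yc = orthogonal_group_carrier[OF y(1)]
      have "s * y = swaprows i l y" using swaprows_mat[OF yc ij(1) l] by (simp add: s_def)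
      then have "(s * y) $$ (i, j) = y $$ (l, j)" using ij l yc by simp
      then show ?thesis
        using ij l y yc K_mat_index[of "s * y" ?n i j \<alpha>] K_mat_index[OF yc l ij(2), of \<alpha>]
        orthogonal_group_carrier[OF s]
        by (simp add: e_def K_mat_mult[OF orthogonal_group_carrier[OF s] yc])
    qed
    then have "(\<integral>\<^sup>+x. e l x \<partial>\<kappa>) = (\<integral>\<^sup>+x. e i (K_mat \<alpha> s * x) \<partial>\<kappa>)"
      by (intro nn_integral_cong) simp
    also have "\<dots> = (\<integral>\<^sup>+x. e i x \<partial>\<kappa>)"
      by (rule haar_nn_integral[OF haar _ m[OF ij(1)]]) (use s in \<open>auto simp: K_grp_eq\<close>)
    finally show ?thesis .
  qed
  have "of_nat ?n * (\<integral>\<^sup>+x. e i x \<partial>\<kappa>) = (\<Sum>l<?n. \<integral>\<^sup>+x. e l x \<partial>\<kappa>)"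
    by (simp add: eq)
  also have "\<dots> = (\<integral>\<^sup>+x. (\<Sum>l<?n. e l x) \<partial>\<kappa>)" by (rule nn_integral_sum[symmetric]) (use m in auto)
  also have "\<dots> = (\<integral>\<^sup>+x. 1 \<partial>\<kappa>)"
  proof (rule nn_integral_cong)
    fix x assume "x \<in> space \<kappa>"
    then obtain y where y: "y \<in> orthogonal_group ?n" "x = K_mat \<alpha> y" unfolding sp K_grp_eq by blast
    have "(\<Sum>l<?n. e l x) = (\<Sum>l<?n. ennreal ((y $$ (l, j))\<^sup>2))"
      using y ij orthogonal_group_carrier[OF y(1)] by (intro sum.cong) (auto simp: e_def K_mat_index)
    also have "\<dots> = ennreal (\<Sum>l<?n. (y $$ (l, j))\<^sup>2)" by (rule sum_ennreal) simp
    also have "\<dots> = 1" using orthogonal_group_cols[OF y(1) ij(2) ij(2)] by (simp add: power2_eq_square)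
    finally show "(\<Sum>l<?n. e l x) = 1" .
  qed
  also have "\<dots> = 1" by (simp add: emeasure_space_1)
  finally have n1: "of_nat ?n * (\<integral>\<^sup>+x. e i x \<partial>\<kappa>) = 1" .
  have "(\<integral>\<^sup>+x. e i x \<partial>\<kappa>) = ennreal (1 / real ?n) * (of_nat ?n * (\<integral>\<^sup>+x. e i x \<partial>\<kappa>))"
  proof -
    have "0 < ?n" using ij by linarith
    then have "ennreal (1 / real ?n) * of_nat ?n = 1"
      by (simp add: ennreal_of_nat_eq_real_of_nat ennreal_mult[symmetric] del: of_nat_add)
    then show ?thesis by (simp add: mult.assoc[symmetric])
  qed
  then show ?thesis unfolding n1 by (simp add: e_def)
qed

text \<open>
  The corner has \<open>k\<^sup>2\<close> entries, so the mean of the sum of their squares is \<open>k\<^sup>2 / (k + N)\<close>; the bound is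
  Markov's inequality.
\<close>

lemma haar_corner_concentration:
  assumes haar: "haar_prob (K_grp \<alpha> k N) \<kappa>" and \<eta>: "\<eta> > 0"
  defines "corner \<equiv> \<lambda>x :: complex mat. \<Sum>i<k. \<Sum>j<k. (cmod (x $$ (\<alpha> + i, \<alpha> + j)))\<^sup>2"
  shows "{x \<in> K_grp \<alpha> k N. corner x < \<eta>} \<in> sets \<kappa>"
    and "measure \<kappa> {x \<in> K_grp \<alpha> k N. corner x < \<eta>} \<ge> 1 - (real k)\<^sup>2 / (real (k + N) * \<eta>)"
proof -
  let ?K = "K_grp \<alpha> k N" and ?n = "k + N"
  have sets: "sets \<kappa> = sets (mat_borel ?K)" and prob: "prob_space \<kappa>"
    using haar by (auto simp: haar_prob_def)
  interpret prob_space \<kappa> by (rule prob)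
  have sp: "space \<kappa> = ?K" using sets_eq_imp_space_eq[OF sets] by (simp add: space_mat_borel[OF K_grp_carrier])
  have me: "(\<lambda>x. (cmod (x $$ (\<alpha> + i, \<alpha> + j)))\<^sup>2) \<in> borel_measurable \<kappa>" if "i < k" "j < k" for i j
  proof -
    have "(\<lambda>x. x $$ (\<alpha> + i, \<alpha> + j)) \<in> borel_measurable \<kappa>"
      using entry_measurable[OF K_grp_carrier, of "\<alpha> + i" \<alpha> k N "\<alpha> + j"] that measurable_cong_sets[OF sets refl]
      by auto
    then show ?thesis by measurable
  qed
  have m: "corner \<in> borel_measurable \<kappa>"
    unfolding corner_def by (intro borel_measurable_sum me) auto
  show meas: "{x \<in> ?K. corner x < \<eta>} \<in> sets \<kappa>"
    using borel_measurable_less[OF m borel_measurable_const] by (simp add: sp)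
  have "emeasure \<kappa> {x \<in> space \<kappa>. 1 \<le> ennreal (1 / \<eta>) * ennreal (corner x)}
      \<le> ennreal (1 / \<eta>) * (\<integral>\<^sup>+ x. ennreal (corner x) * indicator (space \<kappa>) x \<partial>\<kappa>)"
    using m by (intro nn_integral_Markov_inequality) auto
  also have "(\<integral>\<^sup>+ x. ennreal (corner x) * indicator (space \<kappa>) x \<partial>\<kappa>)
      = (\<integral>\<^sup>+ x. (\<Sum>i<k. \<Sum>j<k. ennreal ((cmod (x $$ (\<alpha> + i, \<alpha> + j)))\<^sup>2)) \<partial>\<kappa>)"
    by (intro nn_integral_cong) (simp add: corner_def sum_nonneg)
  also have "\<dots> = (\<Sum>i<k. \<Sum>j<k. \<integral>\<^sup>+ x. ennreal ((cmod (x $$ (\<alpha> + i, \<alpha> + j)))\<^sup>2) \<partial>\<kappa>)"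
  proof (subst nn_integral_sum)
    show "(\<lambda>x. \<Sum>j<k. ennreal ((cmod (x $$ (\<alpha> + i, \<alpha> + j)))\<^sup>2)) \<in> borel_measurable \<kappa>" if "i \<in> {..<k}" for i
      using that by (intro borel_measurable_sum measurable_compose[OF me measurable_ennreal]) auto
    show "(\<Sum>i<k. \<integral>\<^sup>+ x. (\<Sum>j<k. ennreal ((cmod (x $$ (\<alpha> + i, \<alpha> + j)))\<^sup>2)) \<partial>\<kappa>)
      = (\<Sum>i<k. \<Sum>j<k. \<integral>\<^sup>+ x. ennreal ((cmod (x $$ (\<alpha> + i, \<alpha> + j)))\<^sup>2) \<partial>\<kappa>)"
      by (intro sum.cong refl nn_integral_sum measurable_compose[OF me measurable_ennreal]) auto
  qed
  also have "\<dots> = (\<Sum>i<k. \<Sum>j<k. ennreal (1 / real ?n))"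
    by (intro sum.cong refl haar_entry_moment[OF haar]) auto
  also have "\<dots> = ennreal ((real k)\<^sup>2 / real ?n)"
    by (simp add: ennreal_of_nat_eq_real_of_nat ennreal_mult[symmetric] power2_eq_square del: of_nat_add)
  also have "ennreal (1 / \<eta>) * \<dots> = ennreal ((real k)\<^sup>2 / (real ?n * \<eta>))"
    using \<eta> by (simp add: ennreal_mult[symmetric] mult.commute)
  also have "{x \<in> space \<kappa>. 1 \<le> ennreal (1 / \<eta>) * ennreal (corner x)} = {x \<in> ?K. \<not> corner x < \<eta>}"
  proof -
    have "1 \<le> ennreal (1 / \<eta>) * ennreal (corner x) \<longleftrightarrow> \<not> corner x < \<eta>" for x
    proof -
      have c0: "0 \<le> corner x" by (simp add: corner_def sum_nonneg)
      have "ennreal (1 / \<eta>) * ennreal (corner x) = ennreal (corner x / \<eta>)"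
        using \<eta> c0 by (simp add: ennreal_mult[symmetric])
      then show ?thesis using \<eta> c0 by (simp add: not_less le_divide_eq)
    qed
    then show ?thesis by (simp add: sp)
  qed
  finally have "measure \<kappa> {x \<in> ?K. \<not> corner x < \<eta>} \<le> (real k)\<^sup>2 / (real ?n * \<eta>)"
    unfolding emeasure_eq_measure using \<eta> by (simp del: of_nat_add)
  moreover have "measure \<kappa> {x \<in> ?K. \<not> corner x < \<eta>} = 1 - measure \<kappa> {x \<in> ?K. corner x < \<eta>}"
  proof -
    have "{x \<in> ?K. \<not> corner x < \<eta>} = space \<kappa> - {x \<in> ?K. corner x < \<eta>}" by (auto simp: sp)
    then show ?thesis using prob_compl[OF meas] by simp
  qed
  ultimately show "measure \<kappa> {x \<in> ?K. corner x < \<eta>} \<ge> 1 - (real k)\<^sup>2 / (real ?n * \<eta>)" by linarith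
qed

section \<open>Concentration near the double coset\<close>

lemma J_mat_unitary: "k \<le> N \<Longrightarrow> J_mat \<alpha> k N \<in> G_grp \<alpha> k N"
  unfolding J_mat_eq G_grp_def by (intro K_mat_unitary J_real_orthogonal)

lemma circ_coset_subset:
  assumes "k \<le> N" "g \<in> unitary_group (\<alpha> + 2 * k)" "h \<in> unitary_group (\<alpha> + 2 * k)"
  shows "circ_coset \<alpha> k N g h \<subseteq> G_grp \<alpha> k N"
proof -
  show ?thesis
    using J_mat_unitary[OF assms(1), of \<alpha>] embed_G_unitary[OF assms(2), of N] embed_G_unitary[OF assms(3), of N] K_grp_unitary[of \<alpha> k N]
    unfolding circ_coset_def G_grp_def by (auto intro!: unitary_group_mult)
qed

lemma mult_mat_assoc4:
  assumes "A \<in> carrier_mat n n" "B \<in> carrier_mat n n" "C \<in> carrier_mat n n" "D \<in> carrier_mat n n"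
  shows "A * (B * C * D) = A * B * C * D"
  using assms by (simp add: assoc_mult_mat[of _ n n _ n _ n] mult_carrier_mat[of _ n n _ n])

lemma nbhd_circ_coset_mult:
  assumes kN: "k \<le> N" and g: "g \<in> unitary_group (\<alpha> + 2 * k)" and h: "h \<in> unitary_group (\<alpha> + 2 * k)"
    and u: "u \<in> K_grp \<alpha> k N" and w: "w \<in> nbhd (G_grp \<alpha> k N) \<epsilon> (circ_coset \<alpha> k N g h)"
  shows "u * w \<in> nbhd (G_grp \<alpha> k N) \<epsilon> (circ_coset \<alpha> k N g h)"
    and "w * u \<in> nbhd (G_grp \<alpha> k N) \<epsilon> (circ_coset \<alpha> k N g h)"
proof -
  let ?n = "\<alpha> + 2 * (k + N)"
  let ?m = "embed_G \<alpha> k N g * J_mat \<alpha> k N * embed_G \<alpha> k N h"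
  obtain a where a: "a \<in> circ_coset \<alpha> k N g h" "op_dist w a < \<epsilon>" and wG: "w \<in> unitary_group ?n"
    using w by (auto simp: nbhd_def G_grp_def)
  have uG: "u \<in> unitary_group ?n" using u K_grp_unitary[of \<alpha> k N] by (auto simp: G_grp_def)
  have aG: "a \<in> unitary_group ?n" using a circ_coset_subset[OF kN g h] by (auto simp: G_grp_def)
  note c = wG[THEN unitary_group_carrier] uG[THEN unitary_group_carrier] aG[THEN unitary_group_carrier]
  obtain s t where st: "s \<in> K_grp \<alpha> k N" "t \<in> K_grp \<alpha> k N" "a = s * ?m * t"
    using a(1) by (auto simp: circ_coset_def)
  have "?m \<in> unitary_group ?n"
    using J_mat_unitary[OF kN, of \<alpha>] embed_G_unitary[OF g, of N] embed_G_unitary[OF h, of N]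
    unfolding G_grp_def by (intro unitary_group_mult)
  then have mc: "?m \<in> carrier_mat ?n ?n" by (rule unitary_group_carrier)
  have stc: "s \<in> carrier_mat ?n ?n" "t \<in> carrier_mat ?n ?n" using st K_grp_carrier by blast+
  have "u * a = (u * s) * ?m * t"
    unfolding st(3) using c stc mc
    by (intro mult_mat_assoc4[of _ ?n]) auto
  then have ua: "u * a \<in> circ_coset \<alpha> k N g h"
    using st u unfolding circ_coset_def by (blast intro: K_grp_mult)
  have "a * u = s * ?m * (t * u)"
    unfolding st(3) using c stc mc by (intro assoc_mult_mat[of _ ?n ?n _ ?n _ ?n]) auto
  then have au: "a * u \<in> circ_coset \<alpha> k N g h"
    using st u unfolding circ_coset_def by (blast intro: K_grp_mult)
  have "op_dist (u * w) (u * a) \<le> op_dist w a"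
    using c op_norm_unitary_mult[OF uG, of "w - a"]
    by (simp add: op_dist_def mult_minus_distrib_mat[of u ?n ?n w ?n a] minus_carrier_mat)
  then show "u * w \<in> nbhd (G_grp \<alpha> k N) \<epsilon> (circ_coset \<alpha> k N g h)"
    using ua a(2) unitary_group_mult[OF uG wG] unfolding nbhd_def G_grp_def by force
  have "op_dist (w * u) (a * u) \<le> op_dist w a"
    using c op_norm_mult_unitary[OF uG, of "w - a"]
    by (simp add: op_dist_def minus_mult_distrib_mat[of w ?n ?n a u ?n] minus_carrier_mat)
  then show "w * u \<in> nbhd (G_grp \<alpha> k N) \<epsilon> (circ_coset \<alpha> k N g h)"
    using au a(2) unitary_group_mult[OF wG uG] unfolding nbhd_def G_grp_def by force
qed

text \<open>
  With \<open>x' = y x z\<close> close to \<open>J\<close> and \<open>y\<close>, \<open>z\<close> from \<open>O(N)\<close>, the element \<open>g x h\<close> lies in the double coset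
  of \<open>g x' h\<close>, and \<open>\<parallel>g x' h - g J h\<parallel> \<le> \<parallel>x' - J\<parallel>\<close> since \<open>g\<close> and \<open>h\<close> are isometries. The number
  \<open>24 k\<^sup>2 \<surd>\<eta>\<close> is the sum of the entrywise bounds: two copies of a block with \<open>(2k)\<^sup>2\<close> entries, each of
  them at most \<open>3 \<surd>\<eta>\<close>.
\<close>

lemma near_circ_coset:
  assumes kN: "k \<le> N" and g: "g \<in> unitary_group (\<alpha> + 2 * k)" and h: "h \<in> unitary_group (\<alpha> + 2 * k)"
    and x: "x \<in> orthogonal_group (k + N)"
    and corner: "(\<Sum>i<k. \<Sum>j<k. (x $$ (i, j))\<^sup>2) \<le> \<eta>"
    and small: "16 * real k * \<eta> \<le> 1" and \<epsilon>: "24 * (real k)\<^sup>2 * sqrt \<eta> < \<epsilon>"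
  shows "embed_G \<alpha> k N g * K_mat \<alpha> x * embed_G \<alpha> k N h
    \<in> nbhd (G_grp \<alpha> k N) \<epsilon> (circ_coset \<alpha> k N g h)"
proof -
  define n where "n = \<alpha> + 2 * (k + N)"
  define E where "E = embed_G \<alpha> k N g"
  define F where "F = embed_G \<alpha> k N h"
  define J where "J = J_mat \<alpha> k N"
  obtain y z where y: "y \<in> orthogonal_group N" and z: "z \<in> orthogonal_group N"
    and near: "\<And>i j. i < k + N \<Longrightarrow> j < k + N \<Longrightarrow>
      \<bar>((1\<^sub>m k \<oplus>\<^sub>d y) * x * (1\<^sub>m k \<oplus>\<^sub>d z)) $$ (i, j) - J_real k N $$ (i, j)\<bar>
        \<le> (if i < 2 * k \<and> j < 2 * k then 3 * sqrt \<eta> else 0)"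
    using near_J_real[OF x kN corner small] by blast
  define Y where "Y = K_mat \<alpha> (1\<^sub>m k \<oplus>\<^sub>d y)"
  define Z where "Z = K_mat \<alpha> (1\<^sub>m k \<oplus>\<^sub>d z)"
  define x' where "x' = (1\<^sub>m k \<oplus>\<^sub>d y) * x * (1\<^sub>m k \<oplus>\<^sub>d z)"
  have oy: "1\<^sub>m k \<oplus>\<^sub>d y \<in> orthogonal_group (k + N)" and oz: "1\<^sub>m k \<oplus>\<^sub>d z \<in> orthogonal_group (k + N)"
    by (intro orthogonal_group_dsum orthogonal_group_one y z)+
  have x': "x' \<in> orthogonal_group (k + N)" unfolding x'_def by (intro orthogonal_group_mult oy oz x)
  have YK: "Y \<in> K_grp \<alpha> k N" and ZK: "Z \<in> K_grp \<alpha> k N"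
    using oy oz by (auto simp: K_grp_eq Y_def Z_def)
  have E: "E \<in> unitary_group n" and F: "F \<in> unitary_group n" and J: "J \<in> unitary_group n"
    using embed_G_unitary[OF g, of N] embed_G_unitary[OF h, of N] J_mat_unitary[OF kN, of \<alpha>]
    by (simp_all add: E_def F_def J_def G_grp_def n_def)
  have Y: "Y \<in> unitary_group n" and Z: "Z \<in> unitary_group n" and X: "K_mat \<alpha> x \<in> unitary_group n"
    and X': "K_mat \<alpha> x' \<in> unitary_group n"
    unfolding Y_def Z_def n_def by (intro K_mat_unitary oy oz x x')+
  note c = E[THEN unitary_group_carrier] F[THEN unitary_group_carrier] J[THEN unitary_group_carrier]
    Y[THEN unitary_group_carrier] Z[THEN unitary_group_carrier] X[THEN unitary_group_carrier]
    X'[THEN unitary_group_carrier]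
  note assoc = assoc_mult_mat[of _ n n _ n _ n] mult_carrier_mat[of _ n n _ n]
  have comm: "Y * E = E * Y" "Z * F = F * Z"
    unfolding Y_def Z_def E_def F_def
    by (intro embed_G_commute unitary_group_carrier g h orthogonal_group_carrier y z)+
  have KX': "K_mat \<alpha> x' = Y * K_mat \<alpha> x * Z"
    unfolding x'_def Y_def Z_def using orthogonal_group_carrier[OF oy] orthogonal_group_carrier[OF oz]
      orthogonal_group_carrier[OF x]
    by (simp add: K_mat_mult[of _ "k + N"] mult_carrier_mat[of _ "k + N" "k + N" _ "k + N"])
  have EXF: "E * K_mat \<alpha> x' * F = Y * (E * K_mat \<alpha> x * F) * Z"
  proof -
    have "E * K_mat \<alpha> x' * F = (E * Y) * K_mat \<alpha> x * (Z * F)" unfolding KX' using c by (simp add: assoc)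
    also have "\<dots> = (Y * E) * K_mat \<alpha> x * (F * Z)" by (simp only: comm)
    also have "\<dots> = Y * (E * K_mat \<alpha> x * F) * Z" using c by (simp add: assoc)
    finally show ?thesis .
  qed
  have inC: "E * J * F \<in> circ_coset \<alpha> k N g h"
  proof -
    have one: "1\<^sub>m n \<in> K_grp \<alpha> k N"
      unfolding K_grp_eq n_def by (intro image_eqI[where x = "1\<^sub>m (k + N)"] orthogonal_group_one K_mat_one[symmetric])
    have "E * J * F = 1\<^sub>m n * (E * J * F) * 1\<^sub>m n"
      using c by (simp add: mult_carrier_mat[of _ n n _ n] right_mult_one_mat[of _ n n] left_mult_one_mat[of _ n n])
    then show ?thesis unfolding circ_coset_def E_def F_def J_def using one by blast
  qed
  have "op_dist (E * K_mat \<alpha> x' * F) (E * J * F) = op_norm (E * (K_mat \<alpha> x' - J) * F)"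
    using c by (simp add: op_dist_def mult_minus_distrib_mat[of E n n _ n]
        minus_mult_distrib_mat[of _ n n _ F n] mult_carrier_mat[of _ n n _ n])
  also have "\<dots> \<le> op_norm (E * (K_mat \<alpha> x' - J))" 
    using c by (intro op_norm_mult_unitary[OF F] mult_carrier_mat[of _ n n _ n]) auto
  also have "\<dots> \<le> op_norm (K_mat \<alpha> x' - J)" using c by (intro op_norm_unitary_mult[OF E]) auto
  also have "\<dots> \<le> entry_sum (K_mat \<alpha> x' - J)" by (rule op_norm_le_entry_sum)
  also have "\<dots> = 2 * (\<Sum>i<k + N. \<Sum>j<k + N. \<bar>x' $$ (i, j) - J_real k N $$ (i, j)\<bar>)"
    unfolding J_def J_mat_eq
    by (intro entry_sum_K_mat_diff orthogonal_group_carrier x' J_real_orthogonal kN)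
  also have "\<dots> \<le> 2 * (\<Sum>i<k + N. \<Sum>j<k + N. if i < 2 * k \<and> j < 2 * k then 3 * sqrt \<eta> else 0)"
    unfolding x'_def by (intro mult_left_mono sum_mono near) auto
  also have "(\<Sum>i<k + N. \<Sum>j<k + N. if i < 2 * k \<and> j < 2 * k then 3 * sqrt \<eta> else 0)
      = (\<Sum>i<2 * k. \<Sum>j<2 * k. 3 * sqrt \<eta>)"
  proof -
    have inner: "(\<Sum>j<k + N. if i < 2 * k \<and> j < 2 * k then 3 * sqrt \<eta> else 0)
        = (if i < 2 * k then \<Sum>j<2 * k. 3 * sqrt \<eta> else 0)" for i
    proof (cases "i < 2 * k")
      case True
      have "(\<Sum>j<2 * k. 3 * sqrt \<eta>) = (\<Sum>j<k + N. if i < 2 * k \<and> j < 2 * k then 3 * sqrt \<eta> else 0)"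
        using kN True by (intro sum.mono_neutral_cong_left) auto
      then show ?thesis using True by simp
    qed simp
    have "(\<Sum>i<2 * k. \<Sum>j<2 * k. 3 * sqrt \<eta>) = (\<Sum>i<k + N. if i < 2 * k then \<Sum>j<2 * k. 3 * sqrt \<eta> else 0)"
      using kN by (intro sum.mono_neutral_cong_left) auto
    then show ?thesis by (simp only: inner)
  qed
  also have "2 * \<dots> = 24 * (real k)\<^sup>2 * sqrt \<eta>" by (simp add: power2_eq_square)
  also have "\<dots> < \<epsilon>" by (rule \<epsilon>)
  finally have "E * K_mat \<alpha> x' * F \<in> nbhd (G_grp \<alpha> k N) \<epsilon> (circ_coset \<alpha> k N g h)"
    using inC unitary_group_mult[OF unitary_group_mult[OF E X'] F] unfolding nbhd_def G_grp_def n_def by blast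
  then have "mat_adjoint Y * (E * K_mat \<alpha> x' * F) * mat_adjoint Z \<in> nbhd (G_grp \<alpha> k N) \<epsilon> (circ_coset \<alpha> k N g h)"
    by (rule nbhd_circ_coset_mult(2)[OF kN g h K_grp_inverse[OF ZK]
          nbhd_circ_coset_mult(1)[OF kN g h K_grp_inverse[OF YK]]])
  also have "mat_adjoint Y * (E * K_mat \<alpha> x' * F) * mat_adjoint Z = E * K_mat \<alpha> x * F"
  proof -
    have cancel: "mat_adjoint Y * (Y * W * Z) * mat_adjoint Z = W" if W: "W \<in> carrier_mat n n" for W
      using assoc_mult_mat[OF c(4) W c(5)] unitary_cancel_left(1)[OF Y mult_carrier_mat[OF W c(5)]]
        unitary_cancel_right[OF Z W] by simp
    show ?thesis
      unfolding EXF by (intro cancel mult_carrier_mat[OF mult_carrier_mat[OF c(1) c(6)] c(2)])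
  qed
  finally show ?thesis by (simp add: E_def F_def)
qed

lemma measure_tau:
  fixes \<epsilon> :: real
  assumes kN: "k \<le> N" and haar: "haar_prob (K_grp \<alpha> k N) \<kappa>"
    and g: "g \<in> unitary_group (\<alpha> + 2 * k)" and h: "h \<in> unitary_group (\<alpha> + 2 * k)"
  defines "S \<equiv> nbhd (G_grp \<alpha> k N) \<epsilon> (circ_coset \<alpha> k N g h)"
  defines "Q \<equiv> {x \<in> K_grp \<alpha> k N. embed_G \<alpha> k N g * x * embed_G \<alpha> k N h \<in> S}"
  shows "measure (\<tau>_meas \<alpha> k N \<kappa> g h) S = measure \<kappa> Q" and "Q \<in> sets \<kappa>"
proof -
  let ?n = "\<alpha> + 2 * (k + N)" and ?K = "K_grp \<alpha> k N"
  have K: "?K \<subseteq> unitary_group ?n" using K_grp_unitary[of \<alpha> k N] by (simp add: G_grp_def)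
  have S: "S \<in> sets (U_borel ?n)"
    unfolding S_def G_grp_def
    by (rule nbhd_measurable[OF unitary_group_subset]) (use circ_coset_subset[OF kN g h] in \<open>simp add: G_grp_def\<close>)
  note inv = nbhd_circ_coset_mult[OF kN g h, of _ _ \<epsilon>, folded S_def]
  have left: "u * w \<in> S \<longleftrightarrow> w \<in> S" if "u \<in> ?K" "w \<in> unitary_group ?n" for u w
  proof
    assume "u * w \<in> S"
    from inv(1)[OF K_grp_inverse[OF that(1)] this] show "w \<in> S"
      using unitary_cancel_left(1)[of u ?n w ?n] that K unitary_group_carrier by fastforce
  qed (rule inv(1)[OF that(1)])
  have right: "w * u \<in> S \<longleftrightarrow> w \<in> S" if "u \<in> ?K" "w \<in> unitary_group ?n" for u w
  proof
    assume "w * u \<in> S"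
    from inv(2)[OF K_grp_inverse[OF that(1)] this] show "w \<in> S"
      using unitary_cancel_right[of u ?n w ?n] that K unitary_group_carrier by fastforce
  qed (rule inv(2)[OF that(1)])
  have \<kappa>: "prob_space \<kappa>" "sets \<kappa> = sets (mat_borel ?K)" using haar by (simp_all add: haar_prob_def)
  note B = emeasure_conv_bi_invariant[OF K \<kappa> S left right
      embed_G_unitary[OF g, of N, unfolded G_grp_def] embed_G_unitary[OF h, of N, unfolded G_grp_def]]
  show "Q \<in> sets \<kappa>" unfolding Q_def by (rule B(2))
  show "measure (\<tau>_meas \<alpha> k N \<kappa> g h) S = measure \<kappa> Q"
    unfolding measure_def \<tau>_meas_def Let_def G_grp_def Q_def by (simp only: B(1))
qed

theorem theorem2p2:
  fixes \<alpha> :: nat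
  assumes "\<alpha> > 0"
  shows "\<forall>k > 0. \<forall>\<epsilon> > 0. \<forall>\<delta> > 0. \<exists>N\<^sub>0 \<ge> k. \<forall>N \<ge> N\<^sub>0.
    \<forall>\<kappa>. haar_prob (K_grp \<alpha> k N) \<kappa> \<longrightarrow>
      (\<forall>g \<in> unitary_group (\<alpha> + 2 * k). \<forall>h \<in> unitary_group (\<alpha> + 2 * k).
        measure (\<tau>_meas \<alpha> k N \<kappa> g h) (nbhd (G_grp \<alpha> k N) \<epsilon> (circ_coset \<alpha> k N g h)) \<ge> 1 - \<delta>)"
proof (intro allI impI)
  fix k :: nat and \<epsilon> \<delta> :: real
  assume k: "k > 0" and \<epsilon>: "\<epsilon> > 0" and \<delta>: "\<delta> > 0"
  \<comment> \<open>The first bound is required by the perturbation argument; the second one gives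
    \<open>24 k\<^sup>2 \<surd>\<eta> \<le> (24 / 25) \<epsilon>\<close>.\<close>
  define \<eta> where "\<eta> = min (1 / (16 * real k)) ((\<epsilon> / (25 * (real k)\<^sup>2))\<^sup>2)"
  have \<eta>0: "\<eta> > 0" using k \<epsilon> by (simp add: \<eta>_def)
  have small: "16 * real k * \<eta> \<le> 1"
  proof -
    have "16 * real k * \<eta> \<le> 16 * real k * (1 / (16 * real k))"
      by (intro mult_left_mono) (auto simp: \<eta>_def)
    then show ?thesis using k by simp
  qed
  have bound: "24 * (real k)\<^sup>2 * sqrt \<eta> < \<epsilon>"
  proof -
    have "sqrt \<eta> \<le> \<epsilon> / (25 * (real k)\<^sup>2)" using \<epsilon> by (intro real_le_lsqrt) (auto simp: \<eta>_def)
    then have "24 * (real k)\<^sup>2 * sqrt \<eta> \<le> 24 * (real k)\<^sup>2 * (\<epsilon> / (25 * (real k)\<^sup>2))"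
      by (intro mult_left_mono) auto
    also have "\<dots> = 24 / 25 * \<epsilon>" using k by simp
    also have "\<dots> < \<epsilon>" using \<epsilon> by simp
    finally show ?thesis .
  qed
  \<comment> \<open>By the choice of \<open>N\<^sub>0\<close> the bound \<open>k\<^sup>2 / ((k + N) \<eta>)\<close> for the exceptional set is at most \<open>\<delta>\<close>.\<close>
  define N\<^sub>0 where "N\<^sub>0 = max k (nat \<lceil>(real k)\<^sup>2 / (\<eta> * \<delta>)\<rceil>)"
  show "\<exists>N\<^sub>0 \<ge> k. \<forall>N \<ge> N\<^sub>0.
    \<forall>\<kappa>. haar_prob (K_grp \<alpha> k N) \<kappa> \<longrightarrow>
      (\<forall>g \<in> unitary_group (\<alpha> + 2 * k). \<forall>h \<in> unitary_group (\<alpha> + 2 * k).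
        measure (\<tau>_meas \<alpha> k N \<kappa> g h) (nbhd (G_grp \<alpha> k N) \<epsilon> (circ_coset \<alpha> k N g h)) \<ge> 1 - \<delta>)"
  proof (intro exI[of _ N\<^sub>0] conjI allI impI ballI)
    show "k \<le> N\<^sub>0" by (simp add: N\<^sub>0_def)
    fix N \<kappa> g h
    assume N: "N\<^sub>0 \<le> N" and haar: "haar_prob (K_grp \<alpha> k N) \<kappa>"
      and g: "g \<in> unitary_group (\<alpha> + 2 * k)" and h: "h \<in> unitary_group (\<alpha> + 2 * k)"
    have kN: "k \<le> N" using N by (simp add: N\<^sub>0_def)
    have "(real k)\<^sup>2 / (\<eta> * \<delta>) \<le> real N\<^sub>0" unfolding N\<^sub>0_def by linarith
    also have "\<dots> \<le> real (k + N)" using N by simp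
    finally have "(real k)\<^sup>2 \<le> real (k + N) * (\<eta> * \<delta>)"
      using \<eta>0 \<delta> by (simp only: pos_divide_le_eq mult_pos_pos)
    moreover have "0 < real (k + N) * \<eta>" using \<eta>0 k by (intro mult_pos_pos) auto
    ultimately have d: "(real k)\<^sup>2 / (real (k + N) * \<eta>) \<le> \<delta>"
      by (simp only: pos_divide_le_eq mult_ac)
    interpret prob_space \<kappa> using haar by (simp add: haar_prob_def)
    let ?corner = "\<lambda>x :: complex mat. \<Sum>i<k. \<Sum>j<k. (cmod (x $$ (\<alpha> + i, \<alpha> + j)))\<^sup>2"
    let ?S = "nbhd (G_grp \<alpha> k N) \<epsilon> (circ_coset \<alpha> k N g h)"
    let ?Q = "{x \<in> K_grp \<alpha> k N. embed_G \<alpha> k N g * x * embed_G \<alpha> k N h \<in> ?S}"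
    have sub: "{x \<in> K_grp \<alpha> k N. ?corner x < \<eta>} \<subseteq> ?Q"
    proof safe
      fix x assume xK: "x \<in> K_grp \<alpha> k N" and cx: "?corner x < \<eta>"
      then obtain w where w: "w \<in> orthogonal_group (k + N)" "x = K_mat \<alpha> w" by (auto simp: K_grp_eq)
      have "(\<Sum>i<k. \<Sum>j<k. (w $$ (i, j))\<^sup>2) = ?corner x"
        unfolding w(2) by (intro sum.cong refl) (simp add: K_mat_index[OF orthogonal_group_carrier[OF w(1)]])
      then have "(\<Sum>i<k. \<Sum>j<k. (w $$ (i, j))\<^sup>2) \<le> \<eta>" using cx by linarith
      then show "embed_G \<alpha> k N g * x * embed_G \<alpha> k N h \<in> ?S"
        unfolding w(2) by (rule near_circ_coset[OF kN g h w(1) _ small bound])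
    qed
    have "1 - \<delta> \<le> measure \<kappa> {x \<in> K_grp \<alpha> k N. ?corner x < \<eta>}"
      using haar_corner_concentration(2)[OF haar \<eta>0] d by linarith
    also have "\<dots> \<le> measure \<kappa> ?Q"
      by (rule finite_measure_mono[OF sub measure_tau(2)[OF kN haar g h]])
    also have "\<dots> = measure (\<tau>_meas \<alpha> k N \<kappa> g h) ?S"
      by (rule measure_tau(1)[OF kN haar g h, symmetric])
    finally show "1 - \<delta> \<le> measure (\<tau>_meas \<alpha> k N \<kappa> g h) ?S" .
  qed
qed

end
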